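(* Let $n_u>n_t$ be positive integers, let $A\in\mathbb{R}^{n_u\times n_u}$ be symmetric positive semidefinite, let $B\in\mathbb{R}^{n_u\times n_t}$ have full rank, and let $C\in\mathbb{R}^{n_t\times n_t}$ be symmetric positive definite. Set $S_u=A+BC^{-1}B^T$, let $\widetilde{S}_u^{-1}$ be an operator used as an approximation of $S_u^{-1}$ (with $\widetilde{S}_u$ symmetric positive definite, so that $\widetilde{S}_u^{-1/2}$ is defined), and let $$\mathcal{A}=\begin{bmatrix} A & B \\ B^T & 0 \end{bmatrix},\qquad \mathcal{M}^{-1}=\begin{bmatrix} I_u & 0 \\ C^{-1}B^T & I_t \end{bmatrix}\begin{bmatrix} \widetilde{S}_u^{-1} & 0 \\ 0 & -C^{-1} \end{bmatrix}\begin{bmatrix} I_u & BC^{-1} \\ 0 & I_t \end{bmatrix}.$$ Let $$\alpha_u=\lambda_{\min}\left(\widetilde{S}_u^{-1}(S_u+BC^{-1}B^T)\right),\qquad \beta_u=\lambda_{\max}\left(\widetilde{S}_u^{-1}(S_u+BC^{-1}B^T)\right),$$ $$\alpha_t=\sigma_{\min}\left(\widetilde{S}_u^{-1/2}BC^{-1/2}\right),\qquad \beta_t=\sigma_{\max}\left(\widetilde{S}_u^{-1/2}BC^{-1/2}\right).$$ Then the real eigenvalues $\lambda$ of $\mathcal{M}^{-1}\mathcal{A}$ are such that $$\min\left\{\alpha_u,\frac{2\alpha_t^2}{\beta_u+\sqrt{\beta_u^2-4\alpha_t^2}}\right\}\le\lambda\le\beta_u,$$ and the real and imaginary parts, $\lambda_{\Re}$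 and $\lambda_{\Im}$, of the complex (non-real) eigenvalues of $\mathcal{M}^{-1}\mathcal{A}$ are such that $$\frac{\alpha_u}{2}\le\lambda_{\Re}\le\frac{\beta_u}{2},\qquad |\lambda_{\Im}|\le\sqrt{\beta_t^2-\frac{\alpha_u^2}{4}},$$ with no complex (non-real) eigenvalues if $2\beta_t<\alpha_u$.
   Context: All matrices are real; $I_u$ and $I_t$ are the identity matrices of order $n_u$ and $n_t$. Here $\lambda(\cdot)$ and $\sigma(\cdot)$ denote eigenvalues and singular values of the matrix within brackets, and the subscripts $\min$ and $\max$ denote the smallest and largest of them (for the $n_u\times n_t$ matrix $\widetilde{S}_u^{-1/2}BC^{-1/2}$, among its $n_t$ singular values). Powers $-1/2$ denote inverses of symmetric positive definite square roots. The matrix $\mathcal{M}^{-1}$ is a preconditioner for the saddle-point matrix $\mathcal{A}$; $S_u$ is called the primal Schur complement. *)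

theory Defs
  imports
    Complex_Main
    "Jordan_Normal_Form.Gauss_Jordan_Elimination"
    "Jordan_Normal_Form.DL_Rank"
    "Jordan_Normal_Form.Spectral_Radius"
begin

definition sym_pos_semidef :: "nat \<Rightarrow> real mat \<Rightarrow> bool" where
  "sym_pos_semidef n M \<longleftrightarrow>
     M \<in> carrier_mat n n \<and> M\<^sup>T = M \<and> (\<forall>v \<in> carrier_vec n. 0 \<le> v \<bullet> (M *\<^sub>v v))"

definition sym_pos_def :: "nat \<Rightarrow> real mat \<Rightarrow> bool" where
  "sym_pos_def n M \<longleftrightarrow>
     M \<in> carrier_mat n n \<and> M\<^sup>T = M \<and>
     (\<forall>v \<in> carrier_vec n. v \<noteq> 0\<^sub>v n \<longrightarrow> 0 < v \<bullet> (M *\<^sub>v v))"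

text \<open>Only meaningful for invertible matrices.\<close>
abbreviation minv :: "real mat \<Rightarrow> real mat" where
  "minv M \<equiv> the (mat_inverse M)"

text \<open>Only meaningful for symmetric positive definite matrices, where such a root exists and is
  unique.\<close>
definition spd_sqrt :: "real mat \<Rightarrow> real mat" where
  "spd_sqrt M = (THE R. sym_pos_def (dim_row M) R \<and> R * R = M)"

abbreviation inv_sqrt :: "real mat \<Rightarrow> real mat" where
  "inv_sqrt M \<equiv> minv (spd_sqrt M)"

abbreviation complex_mat :: "real mat \<Rightarrow> complex mat" where
  "complex_mat M \<equiv> map_mat complex_of_real M"

text \<open>For a real matrix \<open>spectrum\<close> is the set of its real eigenvalues. The two functions below are
  applied only to products of a symmetric positive definite and a symmetric matrix, all of whose
  complex eigenvalues are real.\<close>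
definition lambda_min :: "real mat \<Rightarrow> real" where
  "lambda_min M = Min (spectrum M)"

definition lambda_max :: "real mat \<Rightarrow> real" where
  "lambda_max M = Max (spectrum M)"

text \<open>As \<open>M\<^sup>T * M\<close> has order \<open>dim_col M\<close>, these are the \<open>dim_col M\<close> singular values
  (without multiplicity) of a matrix with at least as many rows as columns.\<close>
definition singular_values :: "real mat \<Rightarrow> real set" where
  "singular_values M = sqrt ` spectrum (M\<^sup>T * M)"

definition sigma_min :: "real mat \<Rightarrow> real" where
  "sigma_min M = Min (singular_values M)"

definition sigma_max :: "real mat \<Rightarrow> real" where
  "sigma_max M = Max (singular_values M)"

definition primal_schur :: "real mat \<Rightarrow> real mat \<Rightarrow> real mat \<Rightarrow> real mat" where
  "primal_schur A B C = A + B * minv C * B\<^sup>T"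

definition saddle_mat :: "real mat \<Rightarrow> real mat \<Rightarrow> real mat" where
  "saddle_mat A B = four_block_mat A B B\<^sup>T (0\<^sub>m (dim_col B) (dim_col B))"

text \<open>The argument \<open>S\<close> is the approximation of the primal Schur complement itself, not its
  inverse.\<close>
definition precond_inv :: "real mat \<Rightarrow> real mat \<Rightarrow> real mat \<Rightarrow> real mat" where
  "precond_inv B C S =
     (let nu = dim_row B; nt = dim_col B in
      four_block_mat (1\<^sub>m nu) (0\<^sub>m nu nt) (minv C * B\<^sup>T) (1\<^sub>m nt) *
      four_block_mat (minv S) (0\<^sub>m nu nt) (0\<^sub>m nt nu) (- minv C) *
      four_block_mat (1\<^sub>m nu) (B * minv C) (0\<^sub>m nt nu) (1\<^sub>m nt))"

end

(* Conjugating Minv * A by block triangular and block diagonal factors turns it into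
   X = [G, H; -H^T, 0] with G = St^(-1/2) (S_u + B C^(-1) B^T) St^(-1/2) symmetric positive
   semidefinite and H = St^(-1/2) B C^(-1/2); G has the eigenvalues alpha_u, ..., beta_u.
   Taking inner products of G u + H p = l u and -H^T u = l p with u and p gives, for non-real l,
   |p| = |u|, 2 Re l |u|^2 = u* G u and |l|^2 |u|^2 = |H^T u|^2. For real l < alpha_u the
   matrix G - l is positive definite, and eliminating u gives alpha_t^2 <= l (beta_u - l). *)

theory Submission
  imports Defs
begin

text \<open>The second copy of B C^(-1) B^T in G comes from the left triangular factor of the
  preconditioner: the right factor turns A into S_u, and carrying the left factor cyclically to the
  right end of the product adds B C^(-1) B^T once more. The minus sign before C^(-1) makes the
  off-diagonal part of X skew, so it drops out of the quadratic form of a real vector. X itself is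
  not symmetric, so complex eigenvectors are unavoidable; they are split into real and imaginary
  parts, which keeps every scalar product real and bilinear. The fraction in the lower bound is the
  smaller root of x^2 - beta_u x + alpha_t^2 with its numerator rationalized. For a negative
  discriminant no real x satisfies alpha_t^2 <= x (beta_u - x), and then every real eigenvalue is at
  least alpha_u. The extreme eigenvalues and singular values are minima and maxima of finite sets;
  an orthogonal diagonalization is what turns them into bounds on quadratic forms.\<close>

text \<open>Premises that equate dimensions leave no dimension variable to be guessed, unlike
  carrier premises, so the simplifier can reassociate products by itself.\<close>

lemma mat_mult_assoc_dim:
  fixes A :: "'a :: semiring_0 mat"
  assumes "dim_col A = dim_row B" and "dim_col B = dim_row C"
  shows "A * B * C = A * (B * C)"
  by (rule assoc_mult_mat[of _ "dim_row A" "dim_col A" _ "dim_col B" _ "dim_col C"]) (use assms in auto)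

lemma mat_vec_assoc_dim:
  fixes A :: "'a :: semiring_0 mat"
  assumes "dim_col A = dim_row B" and "dim_col B = dim_vec v"
  shows "A * B *\<^sub>v v = A *\<^sub>v (B *\<^sub>v v)"
  by (rule assoc_mult_mat_vec[of _ "dim_row A" "dim_col A" _ "dim_col B"])
    (use assms in \<open>auto intro: carrier_matI carrier_vecI\<close>)

lemma mult_mat_vec_zero [simp]: "dim_col A = m \<Longrightarrow> A *\<^sub>v 0\<^sub>v m = 0\<^sub>v (dim_row A)"
  by (auto intro!: eq_vecI simp: scalar_prod_def)

lemma scalar_prod_transpose:
  fixes A :: "'a :: comm_semiring_0 mat"
  assumes "A \<in> carrier_mat n m" and "v \<in> carrier_vec n" and "w \<in> carrier_vec m"
  shows "v \<bullet> (A *\<^sub>v w) = (A\<^sup>T *\<^sub>v v) \<bullet> w"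
  using transpose_vec_mult_scalar[OF assms(1,3,2)] by simp

lemma scalar_prod_linear_dim:
  fixes u v w :: "'a :: comm_ring vec"
  assumes "dim_vec u = dim_vec w" and "dim_vec v = dim_vec w"
  shows "(u + v) \<bullet> w = u \<bullet> w + v \<bullet> w" and "w \<bullet> (u + v) = w \<bullet> u + w \<bullet> v"
    and "(u - v) \<bullet> w = u \<bullet> w - v \<bullet> w" and "w \<bullet> (u - v) = w \<bullet> u - w \<bullet> v"
  using assms
  by (auto simp: scalar_prod_def algebra_simps sum.distrib sum_subtractf)

lemma real_scalar_prod_self_ge_0: "0 \<le> (v :: real vec) \<bullet> v"
  by (auto simp: scalar_prod_def intro: sum_nonneg)

lemma real_scalar_prod_self_eq_0:
  fixes v :: "real vec"
  assumes "v \<in> carrier_vec n"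
  shows "v \<bullet> v = 0 \<longleftrightarrow> v = 0\<^sub>v n"
  using assms conjugate_square_eq_0_vec[of v n]
  by (auto simp: conjugate_vec_def scalar_prod_def)

lemma real_scalar_prod_self_gt_0:
  fixes v :: "real vec"
  assumes "v \<in> carrier_vec n" and "v \<noteq> 0\<^sub>v n"
  shows "0 < v \<bullet> v"
  using real_scalar_prod_self_ge_0[of v] real_scalar_prod_self_eq_0[OF assms(1)] assms(2) by linarith

text \<open>A real matrix commutes with taking real and imaginary parts, so these parts of a complex
  eigenvector span a real invariant subspace. Either part may vanish, but not both.\<close>

lemma complex_mat_eigenvalue_real_parts:
  fixes M :: "real mat"
  assumes M: "M \<in> carrier_mat n n" and ev: "eigenvalue (complex_mat M) l"
  obtains a b where "a \<in> carrier_vec n" and "b \<in> carrier_vec n" and "a \<noteq> 0\<^sub>v n \<or> b \<noteq> 0\<^sub>v n"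
    and "M *\<^sub>v a = Re l \<cdot>\<^sub>v a + (- Im l) \<cdot>\<^sub>v b" and "M *\<^sub>v b = Re l \<cdot>\<^sub>v b + Im l \<cdot>\<^sub>v a"
proof -
  from ev M obtain u where u: "u \<in> carrier_vec n" "u \<noteq> 0\<^sub>v n"
    and eq: "complex_mat M *\<^sub>v u = l \<cdot>\<^sub>v u"
    by (auto simp: eigenvalue_def eigenvector_def)
  have row: "(\<Sum>j<n. of_real (M $$ (i,j)) * u $ j) = l * u $ i" if "i < n" for i
    using arg_cong[OF eq, of "\<lambda>v. v $ i"] that M u by (simp add: scalar_prod_def atLeast0LessThan)
  show ?thesis
  proof
    show "map_vec Re u \<in> carrier_vec n" "map_vec Im u \<in> carrier_vec n" using u by auto
    show "map_vec Re u \<noteq> 0\<^sub>v n \<or> map_vec Im u \<noteq> 0\<^sub>v n"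
    proof (rule ccontr)
      assume c: "\<not> ?thesis"
      have "u $ i = 0" if "i < n" for i
      proof -
        have "map_vec Re u $ i = 0" "map_vec Im u $ i = 0" using c that by simp_all
        then show ?thesis using that u by (simp add: complex_eq_iff)
      qed
      with u show False by (auto intro!: eq_vecI)
    qed
    show "M *\<^sub>v map_vec Re u = Re l \<cdot>\<^sub>v map_vec Re u + (- Im l) \<cdot>\<^sub>v map_vec Im u"
    proof (rule eq_vecI)
      fix i assume "i < dim_vec (Re l \<cdot>\<^sub>v map_vec Re u + (- Im l) \<cdot>\<^sub>v map_vec Im u)"
      then show "(M *\<^sub>v map_vec Re u) $ i = (Re l \<cdot>\<^sub>v map_vec Re u + (- Im l) \<cdot>\<^sub>v map_vec Im u) $ i"
        using arg_cong[OF row[of i], of Re] M u by (simp add: scalar_prod_def atLeast0LessThan)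
    qed (use M u in auto)
    show "M *\<^sub>v map_vec Im u = Re l \<cdot>\<^sub>v map_vec Im u + Im l \<cdot>\<^sub>v map_vec Re u"
    proof (rule eq_vecI)
      fix i assume "i < dim_vec (Re l \<cdot>\<^sub>v map_vec Im u + Im l \<cdot>\<^sub>v map_vec Re u)"
      then show "(M *\<^sub>v map_vec Im u) $ i = (Re l \<cdot>\<^sub>v map_vec Im u + Im l \<cdot>\<^sub>v map_vec Re u) $ i"
        using arg_cong[OF row[of i], of Im] M u by (simp add: scalar_prod_def atLeast0LessThan)
    qed (use M u in auto)
  qed
qed

section \<open>Spectral theorem for real symmetric matrices\<close>

text \<open>A complex eigenvalue exists because the characteristic polynomial has a root. Symmetry
  equates \<open>a \<bullet> (M *\<^sub>v b)\<close> with
  \<open>(M *\<^sub>v a) \<bullet> b\<close>, and the difference of the two is Im l times the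
  squared norm of the eigenvector, so l is real.\<close>

lemma symmetric_mat_has_real_eigenvector:
  fixes M :: "real mat"
  assumes M: "M \<in> carrier_mat n n" and sym: "M\<^sup>T = M" and "0 < n"
  obtains e v where "v \<in> carrier_vec n" and "v \<noteq> 0\<^sub>v n" and "M *\<^sub>v v = e \<cdot>\<^sub>v v"
proof -
  from spectrum_non_empty[of "complex_mat M" n] assms
  obtain l where "eigenvalue (complex_mat M) l" by (auto simp: spectrum_def)
  from complex_mat_eigenvalue_real_parts[OF M this]
  obtain a b where a: "a \<in> carrier_vec n" and b: "b \<in> carrier_vec n" and nz: "a \<noteq> 0\<^sub>v n \<or> b \<noteq> 0\<^sub>v n"
    and Ma: "M *\<^sub>v a = Re l \<cdot>\<^sub>v a + (- Im l) \<cdot>\<^sub>v b" and Mb: "M *\<^sub>v b = Re l \<cdot>\<^sub>v b + Im l \<cdot>\<^sub>v a"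
    by blast
  have "a \<bullet> (M *\<^sub>v b) = (M *\<^sub>v a) \<bullet> b" using scalar_prod_transpose[OF M a b] sym by simp
  then have "Im l * (a \<bullet> a + b \<bullet> b) = 0"
    unfolding Ma Mb using a b by (simp add: scalar_prod_linear_dim algebra_simps)
  moreover have "a \<bullet> a + b \<bullet> b > 0"
    using nz real_scalar_prod_self_gt_0[OF a] real_scalar_prod_self_gt_0[OF b]
      real_scalar_prod_self_ge_0[of a] real_scalar_prod_self_ge_0[of b] by fastforce
  ultimately have "Im l = 0" by simp
  with Ma Mb a b have "M *\<^sub>v a = Re l \<cdot>\<^sub>v a" "M *\<^sub>v b = Re l \<cdot>\<^sub>v b"
    by (auto simp: vec_eq_iff)
  with nz a b that show ?thesis by blast
qed

text \<open>Supplies an orthogonal matrix with a prescribed first column without completing a basis: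
  the reflection I - 2 w w^T / |w|^2 along w = v - e_0 exchanges e_0 and v. It degenerates for w =
  0, which is the separate case.\<close>

lemma householder_reflection:
  fixes v :: "real vec"
  assumes v: "v \<in> carrier_vec n" and unit: "v \<bullet> v = 1" and n: "0 < n"
  obtains W where "W \<in> carrier_mat n n" and "W\<^sup>T = W" and "W * W = 1\<^sub>m n"
    and "W *\<^sub>v unit_vec n 0 = v"
proof (cases "v = unit_vec n 0")
  case True
  show ?thesis by (rule that[of "1\<^sub>m n"]) (use True in auto)
next
  case False
  define w where "w = v - unit_vec n 0"
  define c where "c = w \<bullet> w"
  define W where "W = mat n n (\<lambda>(i,j). (if i = j then 1 else 0) - 2 / c * w $ i * w $ j)"
  have w: "w \<in> carrier_vec n" using v by (simp add: w_def)
  have "w \<noteq> 0\<^sub>v n"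
  proof
    assume w0: "w = 0\<^sub>v n"
    have "v $ i = unit_vec n 0 $ i" if "i < n" for i
    proof -
      have "w $ i = 0" using w0 that by simp
      then show ?thesis using that v by (simp add: w_def)
    qed
    with False v show False by (auto intro: eq_vecI)
  qed
  then have c: "c > 0" using real_scalar_prod_self_gt_0[OF w] by (simp add: c_def)
  have csum: "c = (\<Sum>k<n. w $ k * w $ k)"
    using w by (simp add: c_def scalar_prod_def atLeast0LessThan)
  \<comment> \<open>Here both v and e_0 have norm 1. With w_0 = v_0 - 1 this reads c = -2 w_0, so
    that W e_0 = e_0 - (2 / c) w_0 w = e_0 + w = v.\<close>
  have "c = 2 - 2 * v $ 0"
    using v n unit by (simp add: c_def w_def scalar_prod_linear_dim)
  then have cw0: "c = - 2 * w $ 0" using v n by (simp add: w_def)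
  have WW: "W * W = 1\<^sub>m n"
  proof (rule eq_matI)
    fix i j assume ij: "i < dim_row (1\<^sub>m n :: real mat)" "j < dim_col (1\<^sub>m n :: real mat)"
    let ?d = "\<lambda>i j. if i = j then 1 else (0::real)"
    have "(W * W) $$ (i,j) = (\<Sum>k<n. (?d i k - 2 / c * w $ i * w $ k) * (?d k j - 2 / c * w $ k * w $ j))"
      using ij by (simp add: W_def scalar_prod_def atLeast0LessThan)
    also have "\<dots> = (\<Sum>k<n. ?d i k * ?d k j) - (\<Sum>k<n. ?d i k * (2 / c * w $ k * w $ j))
        - (\<Sum>k<n. ?d k j * (2 / c * w $ i * w $ k)) + 4 / c^2 * w $ i * w $ j * (\<Sum>k<n. w $ k * w $ k)"
      by (simp add: algebra_simps sum.distrib sum_subtractf sum_distrib_left sum_divide_distrib power2_eq_square)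
    also have "\<dots> = ?d i j"
    proof -
      have delta: "(\<Sum>k<n. ?d i k * g k) = g i" "(\<Sum>k<n. ?d k j * g k) = g j" for g
        using ij by (simp_all add: if_distrib[of "\<lambda>x. x * _"] cong: if_cong)
      show ?thesis unfolding delta csum[symmetric] using c by (simp add: power2_eq_square)
    qed
    finally show "(W * W) $$ (i,j) = 1\<^sub>m n $$ (i,j)" using ij by simp
  qed (auto simp: W_def)
  have We: "W *\<^sub>v unit_vec n 0 = v"
  proof (rule eq_vecI)
    fix i assume "i < dim_vec v"
    then show "(W *\<^sub>v unit_vec n 0) $ i = v $ i"
      using v n c cw0 by (simp add: W_def) (auto simp: w_def field_simps)
  qed (use v in \<open>simp add: W_def\<close>)
  show ?thesis
    by (rule that[OF _ _ WW We]) (auto simp: W_def intro!: eq_matI)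
qed

lemma dim_mat_diag [simp]: "dim_row (mat_diag n d) = n" "dim_col (mat_diag n d) = n"
  by (simp_all add: mat_diag_def)

text \<open>Deflation: conjugating with a reflection that sends e_0 to a unit eigenvector makes e_0
  an eigenvector. Its column then vanishes below the diagonal, symmetry clears the row as well, and
  the remaining block of order n falls to the induction hypothesis.\<close>

lemma symmetric_mat_diagonalization:
  fixes M :: "real mat"
  assumes "M \<in> carrier_mat n n" and "M\<^sup>T = M"
  shows "\<exists>U d. U \<in> carrier_mat n n \<and> U\<^sup>T * U = 1\<^sub>m n \<and> U * U\<^sup>T = 1\<^sub>m n \<and> M = U * mat_diag n d * U\<^sup>T"
  using assms
proof (induction n arbitrary: M)
  case 0
  then show ?case by (intro exI[of _ "1\<^sub>m 0"] exI) (auto intro!: eq_matI)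
next
  case (Suc n)
  let ?N = "Suc n"
  note M = Suc.prems(1) and sym = Suc.prems(2)
  obtain e v where v: "v \<in> carrier_vec ?N" "v \<noteq> 0\<^sub>v ?N" and ev: "M *\<^sub>v v = e \<cdot>\<^sub>v v"
    using symmetric_mat_has_real_eigenvector[OF M sym zero_less_Suc] by blast
  define w where "w = (1 / sqrt (v \<bullet> v)) \<cdot>\<^sub>v v"
  have vv: "v \<bullet> v > 0" by (rule real_scalar_prod_self_gt_0[OF v])
  have w: "w \<in> carrier_vec ?N" "w \<bullet> w = 1" using v vv by (simp_all add: w_def)
  have Mw: "M *\<^sub>v w = e \<cdot>\<^sub>v w"
    using M v ev by (simp add: w_def mult_mat_vec smult_smult_assoc mult.commute)
  obtain W where W: "W \<in> carrier_mat ?N ?N" "W\<^sup>T = W" "W * W = 1\<^sub>m ?N" "W *\<^sub>v unit_vec ?N 0 = w"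
    by (rule householder_reflection[OF w]) auto
  define K where "K = W * M * W"
  have K: "K \<in> carrier_mat ?N ?N" using W M by (simp add: K_def)
  have K_sym: "K\<^sup>T = K"
    unfolding K_def using W M sym
    by (simp add: transpose_mult[of _ ?N ?N _ ?N] mat_mult_assoc_dim)
  have MWKW: "M = W * K * W"
  proof -
    have "W * K * W = (W * W) * M * (W * W)"
      unfolding K_def using W(1) M by (simp add: mat_mult_assoc_dim)
    then show ?thesis using W M by simp
  qed
  have "K *\<^sub>v unit_vec ?N 0 = W *\<^sub>v (M *\<^sub>v (W *\<^sub>v unit_vec ?N 0))"
    unfolding K_def using W(1) M by (simp add: mat_vec_assoc_dim mat_mult_assoc_dim)
  also have "\<dots> = e \<cdot>\<^sub>v (W *\<^sub>v w)" using W Mw w by (simp add: mult_mat_vec)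
  also have "W *\<^sub>v w = (W * W) *\<^sub>v unit_vec ?N 0" using W(1,4) by (simp add: mat_vec_assoc_dim)
  also have "\<dots> = unit_vec ?N 0" using W(3) by simp
  finally have Ke: "K *\<^sub>v unit_vec ?N 0 = e \<cdot>\<^sub>v unit_vec ?N 0" .
  have col: "K $$ (i,0) = (if i = 0 then e else 0)" if "i < ?N" for i
    using arg_cong[OF Ke, of "\<lambda>v. v $ i"] that K by simp
  have row: "K $$ (0,i) = (if i = 0 then e else 0)" if "i < ?N" for i
    using arg_cong[OF K_sym, of "\<lambda>X. X $$ (i,0)"] that K col[OF that] by simp
  define L where "L = mat n n (\<lambda>(i,j). K $$ (Suc i, Suc j))"
  have L: "L \<in> carrier_mat n n" by (simp add: L_def)
  have "L\<^sup>T = L"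
  proof (rule eq_matI)
    fix i j assume "i < dim_row L" "j < dim_col L"
    then show "L\<^sup>T $$ (i,j) = L $$ (i,j)"
      using arg_cong[OF K_sym, of "\<lambda>X. X $$ (Suc i, Suc j)"] K by (simp add: L_def)
  qed (simp_all add: L_def)
  from Suc.IH[OF L this] obtain V d where V: "V \<in> carrier_mat n n" "V\<^sup>T * V = 1\<^sub>m n" "V * V\<^sup>T = 1\<^sub>m n"
    and Ld: "L = V * mat_diag n d * V\<^sup>T" by blast
  let ?I = "1\<^sub>m 1 :: real mat" and ?Z = "0\<^sub>m 1 n :: real mat" and ?Y = "0\<^sub>m n 1 :: real mat"
  define F where "F = four_block_mat ?I ?Z ?Y V"
  \<comment> \<open>The eigenvalue split off is put in front of those of the smaller block, so all
    later indices shift by one.\<close>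
  define f where "f = (\<lambda>i. case i of 0 \<Rightarrow> e | Suc i \<Rightarrow> d i)"
  have F: "F \<in> carrier_mat ?N ?N" using V by (auto simp: F_def)
  have FT: "F\<^sup>T = four_block_mat ?I ?Z ?Y V\<^sup>T"
    unfolding F_def using V by (subst transpose_four_block_mat[of _ 1 1 _ n _ n]) auto
  have block_mult: "four_block_mat P ?Z ?Y Q * four_block_mat P' ?Z ?Y Q' = four_block_mat (P * P') ?Z ?Y (Q * Q')"
    if "P \<in> carrier_mat 1 1" "P' \<in> carrier_mat 1 1" "Q \<in> carrier_mat n n" "Q' \<in> carrier_mat n n" for P P' Q Q'
    using that by (subst mult_four_block_mat[of _ 1 1 _ n _ n _ _ 1 _ n]) auto
  have FF: "F * F\<^sup>T = 1\<^sub>m ?N" "F\<^sup>T * F = 1\<^sub>m ?N"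
    unfolding FT unfolding F_def using V by (simp_all add: block_mult plus_1_eq_Suc del: One_nat_def)
  have Df: "mat_diag ?N f = four_block_mat (e \<cdot>\<^sub>m ?I) ?Z ?Y (mat_diag n d)"
    by (rule eq_matI) (auto simp: mat_diag_def f_def split: nat.splits)
  have KL: "K = four_block_mat (e \<cdot>\<^sub>m ?I) ?Z ?Y L"
  proof (rule eq_matI)
    fix i j
    assume ij: "i < dim_row (four_block_mat (e \<cdot>\<^sub>m ?I) ?Z ?Y L)" "j < dim_col (four_block_mat (e \<cdot>\<^sub>m ?I) ?Z ?Y L)"
    then show "K $$ (i,j) = four_block_mat (e \<cdot>\<^sub>m ?I) ?Z ?Y L $$ (i,j)"
      using row[of j] col[of i] by (cases i; cases j) (auto simp: L_def)
  qed (use K L in auto)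
  have KF: "K = F * mat_diag ?N f * F\<^sup>T"
    unfolding KL Df FT Ld unfolding F_def using V by (simp add: block_mult mat_mult_assoc_dim del: One_nat_def)
  have UT: "(W * F)\<^sup>T = F\<^sup>T * W" using W F by (simp add: transpose_mult)
  show ?case
  proof (intro exI conjI)
    show "W * F \<in> carrier_mat ?N ?N" using W F by simp
    have "(W * F)\<^sup>T * (W * F) = F\<^sup>T * (W * W) * F"
      unfolding UT using W(1) F by (simp add: mat_mult_assoc_dim)
    then show "(W * F)\<^sup>T * (W * F) = 1\<^sub>m ?N" using W(3) F FF by simp
    have "(W * F) * (W * F)\<^sup>T = W * (F * F\<^sup>T) * W"
      unfolding UT using W(1) F by (simp add: mat_mult_assoc_dim)
    then show "(W * F) * (W * F)\<^sup>T = 1\<^sub>m ?N" using W F FF by simp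
    show "M = W * F * mat_diag ?N f * (W * F)\<^sup>T"
      unfolding UT by (subst MWKW, subst KF) (use W(1) F in \<open>simp add: mat_mult_assoc_dim\<close>)
  qed
qed

lemma quadratic_form_diagonalized:
  fixes U :: "real mat"
  assumes U: "U \<in> carrier_mat n n" and v: "v \<in> carrier_vec n"
  shows "v \<bullet> (U * mat_diag n d * U\<^sup>T *\<^sub>v v) = (\<Sum>i<n. d i * ((U\<^sup>T *\<^sub>v v) $ i)\<^sup>2)"
proof -
  define w where "w = U\<^sup>T *\<^sub>v v"
  have w: "w \<in> carrier_vec n" using U v by (simp add: w_def)
  have "mat_diag n d *\<^sub>v w = vec n (\<lambda>i. d i * w $ i)"
    using w by (intro eq_vecI)
      (auto simp: mat_diag_def scalar_prod_def if_distrib[of "\<lambda>x. x * _"] cong: if_cong)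
  moreover have "U * mat_diag n d * U\<^sup>T *\<^sub>v v = U *\<^sub>v (mat_diag n d *\<^sub>v w)"
    unfolding w_def using U v by (simp add: mat_mult_assoc_dim mat_vec_assoc_dim)
  ultimately have "v \<bullet> (U * mat_diag n d * U\<^sup>T *\<^sub>v v) = w \<bullet> vec n (\<lambda>i. d i * w $ i)"
    using scalar_prod_transpose[OF U v, of "vec n (\<lambda>i. d i * w $ i)"] by (simp add: w_def)
  also have "\<dots> = (\<Sum>i<n. d i * (w $ i)\<^sup>2)"
    by (simp add: scalar_prod_def atLeast0LessThan power2_eq_square algebra_simps)
  finally show ?thesis unfolding w_def .
qed

text \<open>This is the diagonalized quadratic form with all weights 1, for which
  \<open>mat_diag\<close> is the identity.\<close>

lemma orthogonal_mat_norm: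
  fixes U :: "real mat"
  assumes U: "U \<in> carrier_mat n n" "U * U\<^sup>T = 1\<^sub>m n" and v: "v \<in> carrier_vec n"
  shows "(\<Sum>i<n. ((U\<^sup>T *\<^sub>v v) $ i)\<^sup>2) = v \<bullet> v"
  using quadratic_form_diagonalized[OF U(1) v, of "\<lambda>_. 1"] U v by simp

lemma diagonalized_spectrum:
  fixes U :: "real mat"
  assumes U: "U \<in> carrier_mat n n" "U\<^sup>T * U = 1\<^sub>m n" and i: "i < n"
  shows "d i \<in> spectrum (U * mat_diag n d * U\<^sup>T)"
proof -
  define v where "v = U *\<^sub>v unit_vec n i"
  have v: "v \<in> carrier_vec n" using U by (simp add: v_def)
  have UTv: "U\<^sup>T *\<^sub>v v = unit_vec n i"
  proof -
    have "U\<^sup>T *\<^sub>v v = U\<^sup>T * U *\<^sub>v unit_vec n i" unfolding v_def using U(1) by (simp add: mat_vec_assoc_dim)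
    then show ?thesis unfolding U(2) by simp
  qed
  have "v \<noteq> 0\<^sub>v n"
  proof
    assume "v = 0\<^sub>v n"
    then have "unit_vec n i = (0\<^sub>v n :: real vec)" using UTv U by simp
    then have "unit_vec n i $ i = (0 :: real)" using i by simp
    then show False using i by simp
  qed
  moreover have "mat_diag n d *\<^sub>v unit_vec n i = d i \<cdot>\<^sub>v unit_vec n i"
    using i by (intro eq_vecI) (auto simp: mat_diag_def)
  then have "U * mat_diag n d * U\<^sup>T *\<^sub>v v = d i \<cdot>\<^sub>v v"
    using U v UTv
    by (simp add: mat_mult_assoc_dim mat_vec_assoc_dim mult_mat_vec v_def)
  ultimately show ?thesis
    using U v by (auto simp: spectrum_def eigenvalue_def eigenvector_def)
qed

lemma symmetric_spectrum_nonempty: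
  fixes M :: "real mat"
  assumes "M \<in> carrier_mat n n" and "M\<^sup>T = M" and "0 < n"
  shows "spectrum M \<noteq> {}"
  using symmetric_mat_diagonalization[OF assms(1,2)] diagonalized_spectrum[OF _ _ assms(3)] by blast

text \<open>In the eigenbasis the quadratic form is a sum of squared coordinates weighted by the
  \<open>d i\<close>, each of which lies in the finite spectrum and hence between its minimum and
  maximum.\<close>

lemma symmetric_rayleigh_bounds:
  fixes M :: "real mat"
  assumes M: "M \<in> carrier_mat n n" "M\<^sup>T = M" and v: "v \<in> carrier_vec n"
  shows "lambda_min M * (v \<bullet> v) \<le> v \<bullet> (M *\<^sub>v v)" and "v \<bullet> (M *\<^sub>v v) \<le> lambda_max M * (v \<bullet> v)"
proof -
  obtain U d where U: "U \<in> carrier_mat n n" "U\<^sup>T * U = 1\<^sub>m n" "U * U\<^sup>T = 1\<^sub>m n"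
    and Md: "M = U * mat_diag n d * U\<^sup>T"
    using symmetric_mat_diagonalization[OF M] by blast
  have d: "lambda_min M \<le> d i" "d i \<le> lambda_max M" if "i < n" for i
  proof -
    have "d i \<in> spectrum M" using diagonalized_spectrum[OF U(1,2) that] Md by simp
    then show "lambda_min M \<le> d i" "d i \<le> lambda_max M"
      using card_finite_spectrum(1)[OF M(1)] by (simp_all add: lambda_min_def lambda_max_def)
  qed
  show "lambda_min M * (v \<bullet> v) \<le> v \<bullet> (M *\<^sub>v v)" "v \<bullet> (M *\<^sub>v v) \<le> lambda_max M * (v \<bullet> v)"
    unfolding orthogonal_mat_norm[OF U(1,3) v, symmetric]
    by (subst Md, subst quadratic_form_diagonalized[OF U(1) v],
        auto simp: sum_distrib_left d intro!: sum_mono mult_right_mono)+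
qed

lemma sym_pos_semidef_spectrum:
  assumes "sym_pos_semidef n M" and "e \<in> spectrum M"
  shows "0 \<le> e"
proof -
  obtain v where v: "v \<in> carrier_vec n" "v \<noteq> 0\<^sub>v n" "M *\<^sub>v v = e \<cdot>\<^sub>v v"
    using assms by (auto simp: spectrum_def eigenvalue_def eigenvector_def sym_pos_semidef_def)
  then have "0 \<le> v \<bullet> (e \<cdot>\<^sub>v v)" using assms(1) unfolding sym_pos_semidef_def by metis
  then show ?thesis
    using real_scalar_prod_self_gt_0[OF v(1,2)] v by (simp add: zero_le_mult_iff)
qed

lemma sym_pos_def_spectrum:
  assumes "sym_pos_def n M" and "e \<in> spectrum M"
  shows "0 < e"
proof -
  obtain v where v: "v \<in> carrier_vec n" "v \<noteq> 0\<^sub>v n" "M *\<^sub>v v = e \<cdot>\<^sub>v v"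
    using assms by (auto simp: spectrum_def eigenvalue_def eigenvector_def sym_pos_def_def)
  then have "0 < v \<bullet> (e \<cdot>\<^sub>v v)" using assms(1) unfolding sym_pos_def_def by metis
  then show ?thesis
    using real_scalar_prod_self_gt_0[OF v(1,2)] v by (simp add: zero_less_mult_iff)
qed

section \<open>Square roots and inverses of positive definite matrices\<close>

lemma sym_pos_def_sqrt_exists:
  assumes M: "sym_pos_def n M"
  shows "\<exists>R. sym_pos_def n R \<and> R * R = M"
proof -
  have Mc: "M \<in> carrier_mat n n" "M\<^sup>T = M" using M by (auto simp: sym_pos_def_def)
  obtain U d where U: "U \<in> carrier_mat n n" "U\<^sup>T * U = 1\<^sub>m n" "U * U\<^sup>T = 1\<^sub>m n"
    and Md: "M = U * mat_diag n d * U\<^sup>T"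
    using symmetric_mat_diagonalization[OF Mc] by blast
  have d: "0 < d i" if "i < n" for i
    using sym_pos_def_spectrum[OF M] diagonalized_spectrum[OF U(1,2) that] Md by blast
  define E where "E = mat_diag n (\<lambda>i. sqrt (d i))"
  define R where "R = U * E * U\<^sup>T"
  have E: "E \<in> carrier_mat n n" "E\<^sup>T = E" by (auto simp: E_def mat_diag_def intro!: eq_matI)
  have EE: "E * E = mat_diag n d"
    unfolding E_def mat_diag_diag using d by (auto simp: mat_diag_def less_imp_le intro!: eq_matI)
  have R: "R \<in> carrier_mat n n" using U(1) E(1) by (auto simp: R_def)
  have RT: "R\<^sup>T = R"
    unfolding R_def using U E by (simp add: transpose_mult[of _ n n _ n] mat_mult_assoc_dim)
  have "R * R = U * E * (U\<^sup>T * U) * E * U\<^sup>T"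
    unfolding R_def using U(1) E by (simp add: mat_mult_assoc_dim)
  also have "\<dots> = U * (E * E) * U\<^sup>T"
    using U E by (simp add: mat_mult_assoc_dim)
  finally have RR: "R * R = M" using EE Md by simp
  have "0 < v \<bullet> (R *\<^sub>v v)" if v: "v \<in> carrier_vec n" "v \<noteq> 0\<^sub>v n" for v
  proof -
    \<comment> \<open>The map \<open>U\<^sup>T\<close> preserves norms, so v has a nonzero
      coordinate in the eigenbasis, and its positive weight makes the whole sum positive.\<close>
    have "0 < (\<Sum>i<n. ((U\<^sup>T *\<^sub>v v) $ i)\<^sup>2)"
      using real_scalar_prod_self_gt_0[OF v] orthogonal_mat_norm[OF U(1,3) v(1)] by simp
    then have "\<not> (\<forall>i\<in>{..<n}. ((U\<^sup>T *\<^sub>v v) $ i)\<^sup>2 = 0)"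
      using sum.neutral[of "{..<n}" "\<lambda>i. ((U\<^sup>T *\<^sub>v v) $ i)\<^sup>2"] by linarith
    then obtain i where i: "i < n" "(U\<^sup>T *\<^sub>v v) $ i \<noteq> 0" by auto
    have "0 < (\<Sum>i<n. sqrt (d i) * ((U\<^sup>T *\<^sub>v v) $ i)\<^sup>2)"
      using i d by (intro sum_pos2[of _ i]) (auto simp: less_imp_le)
    then show ?thesis
      unfolding R_def E_def quadratic_form_diagonalized[OF U(1) v(1)] .
  qed
  with R RT RR show ?thesis by (auto simp: sym_pos_def_def)
qed

text \<open>Any eigenvector of the symmetric matrix \<open>D = R - Q\<close> has eigenvalue zero,
  because \<open>R * D + D * Q = R * R - Q * Q\<close>.\<close>
lemma sym_pos_def_sqrt_unique:
  assumes R: "sym_pos_def n R" and Q: "sym_pos_def n Q" and eq: "R * R = Q * Q"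
  shows "R = Q"
proof -
  have Rc: "R \<in> carrier_mat n n" "R\<^sup>T = R" and Qc: "Q \<in> carrier_mat n n" "Q\<^sup>T = Q"
    using R Q by (auto simp: sym_pos_def_def)
  define D where "D = R - Q"
  have D: "D \<in> carrier_mat n n" "D\<^sup>T = D"
    using Rc Qc by (auto simp: D_def transpose_minus)
  obtain U d where U: "U \<in> carrier_mat n n" "U\<^sup>T * U = 1\<^sub>m n" "U * U\<^sup>T = 1\<^sub>m n"
    and Dd: "D = U * mat_diag n d * U\<^sup>T"
    using symmetric_mat_diagonalization[OF D] by blast
  have "d i = 0" if "i < n" for i
  proof -
    have "d i \<in> spectrum D" using diagonalized_spectrum[OF U(1,2) that] Dd by simp
    then obtain v where v: "v \<in> carrier_vec n" "v \<noteq> 0\<^sub>v n" and Dv: "D *\<^sub>v v = d i \<cdot>\<^sub>v v"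
      using D by (auto simp: spectrum_def eigenvalue_def eigenvector_def)
    have Dw: "D *\<^sub>v w = R *\<^sub>v w - Q *\<^sub>v w" if "w \<in> carrier_vec n" for w
      unfolding D_def using Rc Qc that by (simp add: minus_mult_distrib_mat_vec)
    have "R *\<^sub>v (D *\<^sub>v v) = R *\<^sub>v (R *\<^sub>v v) - R *\<^sub>v (Q *\<^sub>v v)"
      using Rc Qc v by (simp add: Dw mult_minus_distrib_mat_vec[of _ n n])
    moreover have "R *\<^sub>v (R *\<^sub>v v) = Q *\<^sub>v (Q *\<^sub>v v)"
      using arg_cong[OF eq, of "\<lambda>X. X *\<^sub>v v"] Rc Qc v by (simp add: mat_vec_assoc_dim)
    moreover have "v \<bullet> (R *\<^sub>v (D *\<^sub>v v)) = d i * (v \<bullet> (R *\<^sub>v v))"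
      using Rc v by (simp add: Dv mult_mat_vec[of _ n n])
    ultimately have "v \<bullet> (Q *\<^sub>v (Q *\<^sub>v v)) - v \<bullet> (R *\<^sub>v (Q *\<^sub>v v)) = d i * (v \<bullet> (R *\<^sub>v v))"
      using Rc Qc v by (simp add: scalar_prod_linear_dim)
    moreover have "v \<bullet> (D *\<^sub>v (Q *\<^sub>v v)) = d i * (v \<bullet> (Q *\<^sub>v v))"
      using scalar_prod_transpose[OF D(1) v(1), of "Q *\<^sub>v v"] D Qc v by (simp add: Dv)
    then have "v \<bullet> (R *\<^sub>v (Q *\<^sub>v v)) - v \<bullet> (Q *\<^sub>v (Q *\<^sub>v v)) = d i * (v \<bullet> (Q *\<^sub>v v))"
      using Rc Qc v by (simp add: Dw scalar_prod_linear_dim)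
    \<comment> \<open>The mixed products of R and Q cancel when the two equations are added.\<close>
    ultimately have "d i * (v \<bullet> (R *\<^sub>v v) + v \<bullet> (Q *\<^sub>v v)) = 0" by (simp add: algebra_simps)
    moreover have "0 < v \<bullet> (R *\<^sub>v v)" "0 < v \<bullet> (Q *\<^sub>v v)"
      using R Q v by (auto simp: sym_pos_def_def)
    ultimately show "d i = 0" by simp
  qed
  then have "mat_diag n d = 0\<^sub>m n n" by (auto simp: mat_diag_def intro!: eq_matI)
  then have D0: "D = 0\<^sub>m n n" using Dd U by simp
  show ?thesis
  proof (rule eq_matI)
    fix i j assume "i < dim_row Q" "j < dim_col Q"
    then show "R $$ (i,j) = Q $$ (i,j)"
      using arg_cong[OF D0, of "\<lambda>X. X $$ (i,j)"] Rc Qc by (simp add: D_def)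
  qed (use Rc Qc in auto)
qed

text \<open>Existence and uniqueness together justify the definite description in
  \<open>spd_sqrt\<close>.\<close>

lemma spd_sqrt:
  assumes M: "sym_pos_def n M"
  shows "sym_pos_def n (spd_sqrt M)" and "spd_sqrt M * spd_sqrt M = M"
proof -
  have dim: "dim_row M = n" using M by (auto simp: sym_pos_def_def)
  have "\<exists>!R. sym_pos_def (dim_row M) R \<and> R * R = M"
    unfolding dim using sym_pos_def_sqrt_exists[OF M] sym_pos_def_sqrt_unique by (metis (no_types))
  from theI'[OF this] show "sym_pos_def n (spd_sqrt M)" "spd_sqrt M * spd_sqrt M = M"
    unfolding spd_sqrt_def dim by blast+
qed

text \<open>A kernel vector would contradict definiteness, so the determinant is nonzero and
  \<open>mat_inverse\<close> does return a matrix. Positivity carries over through v . N v = u . M u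
  with u = N v.\<close>

lemma sym_pos_def_inverse:
  assumes M: "sym_pos_def n M"
  shows "M * minv M = 1\<^sub>m n" and "minv M * M = 1\<^sub>m n" and "sym_pos_def n (minv M)"
proof -
  have Mc: "M \<in> carrier_mat n n" "M\<^sup>T = M" using M by (auto simp: sym_pos_def_def)
  have "det M \<noteq> 0"
  proof
    assume "det M = 0"
    then obtain v where v: "v \<in> carrier_vec n" "v \<noteq> 0\<^sub>v n" "M *\<^sub>v v = 0\<^sub>v n"
      using det_0_iff_vec_prod_zero[OF Mc(1)] by blast
    then have "0 < v \<bullet> (M *\<^sub>v v)" using M unfolding sym_pos_def_def by blast
    with v show False by simp
  qed
  from det_non_zero_imp_unit[OF Mc(1) this, of n]
  have "mat_inverse M \<noteq> None" using mat_inverse(1)[OF Mc(1), of n] by blast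
  then obtain N where N: "mat_inverse M = Some N" by blast
  from mat_inverse(2)[OF Mc(1) N] N
  show inv: "M * minv M = 1\<^sub>m n" "minv M * M = 1\<^sub>m n" by auto
  let ?N = "minv M"
  have Nc: "?N \<in> carrier_mat n n" using mat_inverse(2)[OF Mc(1) N] N by simp
  have "?N\<^sup>T * M = 1\<^sub>m n"
    using arg_cong[OF inv(1), of transpose_mat] Mc Nc by (simp add: transpose_mult)
  then have "?N\<^sup>T * (M * ?N) = ?N" using Mc Nc
    by (subst mat_mult_assoc_dim[symmetric]) auto
  then have NT: "?N\<^sup>T = ?N" using inv Nc by simp
  have "0 < v \<bullet> (?N *\<^sub>v v)" if v: "v \<in> carrier_vec n" "v \<noteq> 0\<^sub>v n" for v
  proof -
    let ?u = "?N *\<^sub>v v"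
    have u: "?u \<in> carrier_vec n" using Nc v by simp
    have Mu: "M *\<^sub>v ?u = v"
      using arg_cong[OF inv(1), of "\<lambda>X. X *\<^sub>v v"] Mc Nc v by (simp add: mat_vec_assoc_dim)
    have "?u \<noteq> 0\<^sub>v n"
    proof
      assume "?u = 0\<^sub>v n"
      then have "M *\<^sub>v ?u = 0\<^sub>v n" using Mc(1) by simp
      with Mu v show False by simp
    qed
    then have "0 < ?u \<bullet> (M *\<^sub>v ?u)" using M u by (simp add: sym_pos_def_def)
    then show ?thesis using Mu u v by (simp add: comm_scalar_prod[of _ n])
  qed
  with Nc NT show "sym_pos_def n ?N" by (simp add: sym_pos_def_def)
qed

lemma inv_sqrt_square:
  assumes M: "sym_pos_def n M"
  shows "inv_sqrt M * inv_sqrt M = minv M"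
proof -
  note R = spd_sqrt[OF M]
  note I = sym_pos_def_inverse[OF R(1)] and J = sym_pos_def_inverse[OF M]
  have c: "inv_sqrt M \<in> carrier_mat n n" "spd_sqrt M \<in> carrier_mat n n" "minv M \<in> carrier_mat n n"
    "M \<in> carrier_mat n n"
    using I(3) R(1) J(3) M by (simp_all add: sym_pos_def_def)
  have "inv_sqrt M * inv_sqrt M * M = inv_sqrt M * (inv_sqrt M * spd_sqrt M) * spd_sqrt M"
    using c by (subst R(2)[symmetric]) (simp add: mat_mult_assoc_dim)
  also have "\<dots> = 1\<^sub>m n" using c I by simp
  finally have "inv_sqrt M * inv_sqrt M * M * minv M = minv M" using c by simp
  moreover have "inv_sqrt M * inv_sqrt M * M * minv M = inv_sqrt M * inv_sqrt M * (M * minv M)"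
    using c by (simp add: mat_mult_assoc_dim)
  ultimately show ?thesis using c J by simp
qed

section \<open>Eigenvalues of the skew block matrix\<close>

text \<open>The right-hand side with two vectors serves both cases: c = Re l and d = - Im l or Im l
  for the two parts of a complex eigenvector, and d = 0 for a real one.\<close>

lemma saddle_block_mult:
  fixes G H :: "real mat"
  assumes G: "G \<in> carrier_mat n n" and H: "H \<in> carrier_mat n m"
    and a: "a \<in> carrier_vec (n + m)" and b: "b \<in> carrier_vec (n + m)"
    and eq: "four_block_mat G H (- H\<^sup>T) (0\<^sub>m m m) *\<^sub>v a = c \<cdot>\<^sub>v a + d \<cdot>\<^sub>v b"
  shows "G *\<^sub>v vec_first a n + H *\<^sub>v vec_last a m = c \<cdot>\<^sub>v vec_first a n + d \<cdot>\<^sub>v vec_first b n"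
    and "H\<^sup>T *\<^sub>v vec_first a n = (- c) \<cdot>\<^sub>v vec_last a m + (- d) \<cdot>\<^sub>v vec_last b m"
proof -
  let ?u = "vec_first a n" and ?p = "vec_last a m" and ?v = "vec_first b n" and ?q = "vec_last b m"
  have car: "?u \<in> carrier_vec n" "?p \<in> carrier_vec m" "?v \<in> carrier_vec n" "?q \<in> carrier_vec m" by auto
  have "four_block_mat G H (- H\<^sup>T) (0\<^sub>m m m) *\<^sub>v (?u @\<^sub>v ?p) = c \<cdot>\<^sub>v (?u @\<^sub>v ?p) + d \<cdot>\<^sub>v (?v @\<^sub>v ?q)"
    using eq a b by simp
  moreover have "four_block_mat G H (- H\<^sup>T) (0\<^sub>m m m) *\<^sub>v (?u @\<^sub>v ?p)
      = (G *\<^sub>v ?u + H *\<^sub>v ?p) @\<^sub>v ((- H\<^sup>T) *\<^sub>v ?u + 0\<^sub>m m m *\<^sub>v ?p)"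
    by (rule four_block_mat_mult_vec) (use G H car in auto)
  moreover have "c \<cdot>\<^sub>v (?u @\<^sub>v ?p) + d \<cdot>\<^sub>v (?v @\<^sub>v ?q)
      = (c \<cdot>\<^sub>v ?u + d \<cdot>\<^sub>v ?v) @\<^sub>v (c \<cdot>\<^sub>v ?p + d \<cdot>\<^sub>v ?q)"
    by (intro eq_vecI) auto
  ultimately have "(G *\<^sub>v ?u + H *\<^sub>v ?p) @\<^sub>v ((- H\<^sup>T) *\<^sub>v ?u + 0\<^sub>m m m *\<^sub>v ?p)
      = (c \<cdot>\<^sub>v ?u + d \<cdot>\<^sub>v ?v) @\<^sub>v (c \<cdot>\<^sub>v ?p + d \<cdot>\<^sub>v ?q)" by simp
  moreover have "G *\<^sub>v ?u + H *\<^sub>v ?p \<in> carrier_vec n" "c \<cdot>\<^sub>v ?u + d \<cdot>\<^sub>v ?v \<in> carrier_vec n"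
    using G H car by auto
  ultimately have 1: "G *\<^sub>v ?u + H *\<^sub>v ?p = c \<cdot>\<^sub>v ?u + d \<cdot>\<^sub>v ?v"
    and 2: "(- H\<^sup>T) *\<^sub>v ?u + 0\<^sub>m m m *\<^sub>v ?p = c \<cdot>\<^sub>v ?p + d \<cdot>\<^sub>v ?q"
    using append_vec_eq by blast+
  show "G *\<^sub>v ?u + H *\<^sub>v ?p = c \<cdot>\<^sub>v ?u + d \<cdot>\<^sub>v ?v" by (rule 1)
  show "H\<^sup>T *\<^sub>v ?u = (- c) \<cdot>\<^sub>v ?p + (- d) \<cdot>\<^sub>v ?q"
  proof (rule eq_vecI)
    fix i assume "i < dim_vec ((- c) \<cdot>\<^sub>v ?p + (- d) \<cdot>\<^sub>v ?q)"
    then show "(H\<^sup>T *\<^sub>v ?u) $ i = ((- c) \<cdot>\<^sub>v ?p + (- d) \<cdot>\<^sub>v ?q) $ i"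
      using arg_cong[OF 2, of "\<lambda>v. v $ i"] H by (simp add: scalar_prod_def sum_negf)
  qed (use H in simp)
qed

lemma append_vec_nonzero:
  fixes v :: "real vec"
  assumes "v \<in> carrier_vec (n + m)" and "v \<noteq> 0\<^sub>v (n + m)"
  shows "0 < vec_first v n \<bullet> vec_first v n + vec_last v m \<bullet> vec_last v m"
  using real_scalar_prod_self_gt_0[OF assms]
    scalar_prod_append[of "vec_first v n" n "vec_last v m" m "vec_first v n" "vec_last v m"] assms(1)
  by simp

text \<open>The identities for the real and imaginary parts of an eigenvector \<open>(u, p)\<close> show that
  \<open>p\<close> has the same norm as \<open>u\<close> unless the eigenvalue is real.\<close>
lemma saddle_nonreal_eigenvalue:
  fixes G H :: "real mat"
  assumes G: "G \<in> carrier_mat n n" "G\<^sup>T = G" and H: "H \<in> carrier_mat n m"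
    and G_low: "\<And>v. v \<in> carrier_vec n \<Longrightarrow> \<alpha> * (v \<bullet> v) \<le> v \<bullet> (G *\<^sub>v v)"
    and G_up: "\<And>v. v \<in> carrier_vec n \<Longrightarrow> v \<bullet> (G *\<^sub>v v) \<le> \<beta> * (v \<bullet> v)"
    and H_up: "\<And>v. v \<in> carrier_vec n \<Longrightarrow> (H\<^sup>T *\<^sub>v v) \<bullet> (H\<^sup>T *\<^sub>v v) \<le> t * (v \<bullet> v)"
    and "0 \<le> \<alpha>"
    and ev: "eigenvalue (complex_mat (four_block_mat G H (- H\<^sup>T) (0\<^sub>m m m))) l" and nonreal: "Im l \<noteq> 0"
  shows "\<alpha> / 2 \<le> Re l" and "Re l \<le> \<beta> / 2" and "(Im l)\<^sup>2 \<le> t - \<alpha>\<^sup>2 / 4"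
proof -
  let ?X = "four_block_mat G H (- H\<^sup>T) (0\<^sub>m m m)"
  define x y where "x = Re l" and "y = Im l"
  have X: "?X \<in> carrier_mat (n + m) (n + m)" using G H by auto
  from complex_mat_eigenvalue_real_parts[OF X ev]
  obtain v w where v: "v \<in> carrier_vec (n + m)" and w: "w \<in> carrier_vec (n + m)"
    and nz: "v \<noteq> 0\<^sub>v (n + m) \<or> w \<noteq> 0\<^sub>v (n + m)"
    and Xv: "?X *\<^sub>v v = x \<cdot>\<^sub>v v + (- y) \<cdot>\<^sub>v w" and Xw: "?X *\<^sub>v w = x \<cdot>\<^sub>v w + y \<cdot>\<^sub>v v"
    unfolding x_def y_def by blast
  define a b p q where "a = vec_first v n" and "b = vec_first w n" and "p = vec_last v m" and "q = vec_last w m"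
  note defs = a_def b_def p_def q_def
  have car: "a \<in> carrier_vec n" "b \<in> carrier_vec n" "p \<in> carrier_vec m" "q \<in> carrier_vec m"
    by (simp_all add: defs)
  note Ga = saddle_block_mult(1)[OF G(1) H v w Xv, folded defs]
    and Ha = saddle_block_mult(2)[OF G(1) H v w Xv, folded defs]
    and Gb = saddle_block_mult(1)[OF G(1) H w v Xw, folded defs]
    and Hb = saddle_block_mult(2)[OF G(1) H w v Xw, folded defs]
  have comm: "b \<bullet> a = a \<bullet> b" "q \<bullet> p = p \<bullet> q" "b \<bullet> (G *\<^sub>v a) = a \<bullet> (G *\<^sub>v b)"
    subgoal by (rule comm_scalar_prod[OF car(2,1)])
    subgoal by (rule comm_scalar_prod[OF car(4,3)])
    subgoal using scalar_prod_transpose[OF G(1) car(2,1)] G(2)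
        comm_scalar_prod[of "G *\<^sub>v b" n a] G(1) car by simp
    done
  note tr = scalar_prod_transpose[OF H]
  \<comment> \<open>The complex identity is u* G u + u* H p = l u* u with a + i b for u and p + i q
    for p. Its real part is the sum of \<open>1\<close> and \<open>2\<close>, its imaginary part the
    difference of \<open>4\<close> and \<open>3\<close>; products with H are rewritten by the second
    block row.\<close>
  have 1: "a \<bullet> (G *\<^sub>v a) - x * (p \<bullet> p) + y * (p \<bullet> q) = x * (a \<bullet> a) - y * (a \<bullet> b)"
    using arg_cong[OF Ga, of "\<lambda>z. a \<bullet> z"] car G H
    by (simp add: scalar_prod_linear_dim tr Ha comm)
  have 2: "b \<bullet> (G *\<^sub>v b) - x * (q \<bullet> q) - y * (p \<bullet> q) = x * (b \<bullet> b) + y * (a \<bullet> b)"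
    using arg_cong[OF Gb, of "\<lambda>z. b \<bullet> z"] car G H
    by (simp add: scalar_prod_linear_dim tr Hb comm)
  have 3: "a \<bullet> (G *\<^sub>v b) - x * (p \<bullet> q) - y * (p \<bullet> p) = x * (a \<bullet> b) - y * (b \<bullet> b)"
    using arg_cong[OF Ga, of "\<lambda>z. b \<bullet> z"] car G H
    by (simp add: scalar_prod_linear_dim tr Hb comm)
  have 4: "a \<bullet> (G *\<^sub>v b) - x * (p \<bullet> q) + y * (q \<bullet> q) = x * (a \<bullet> b) + y * (a \<bullet> a)"
    using arg_cong[OF Gb, of "\<lambda>z. a \<bullet> z"] car G H
    by (simp add: scalar_prod_linear_dim tr Ha comm)
  \<comment> \<open>In the sum of \<open>5\<close> and \<open>6\<close> the cross terms cancel,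
    which leaves |l|^2 times P.\<close>
  have 5: "(H\<^sup>T *\<^sub>v a) \<bullet> (H\<^sup>T *\<^sub>v a) = x\<^sup>2 * (p \<bullet> p) - 2 * x * y * (p \<bullet> q) + y\<^sup>2 * (q \<bullet> q)"
    unfolding Ha using car by (simp add: scalar_prod_linear_dim comm power2_eq_square algebra_simps)
  have 6: "(H\<^sup>T *\<^sub>v b) \<bullet> (H\<^sup>T *\<^sub>v b) = x\<^sup>2 * (q \<bullet> q) + 2 * x * y * (p \<bullet> q) + y\<^sup>2 * (p \<bullet> p)"
    unfolding Hb using car by (simp add: scalar_prod_linear_dim comm power2_eq_square algebra_simps)
  define N where "N = a \<bullet> a + b \<bullet> b"
  define P where "P = p \<bullet> p + q \<bullet> q"
  \<comment> \<open>Subtraction removes a . G b, because G is symmetric and contributes nothing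
    imaginary.\<close>
  have "y * (P - N) = 0" using 3 4 unfolding N_def P_def by (simp add: algebra_simps)
  then have PN: "P = N" using nonreal by (simp add: y_def)
  have "0 < N + P"
    using nz append_vec_nonzero[OF v] append_vec_nonzero[OF w]
      real_scalar_prod_self_ge_0[of a] real_scalar_prod_self_ge_0[of b]
      real_scalar_prod_self_ge_0[of p] real_scalar_prod_self_ge_0[of q]
    unfolding N_def P_def defs by argo
  then have N: "0 < N" using PN by simp
  have g: "a \<bullet> (G *\<^sub>v a) + b \<bullet> (G *\<^sub>v b) = 2 * x * N"
  proof -
    have "a \<bullet> (G *\<^sub>v a) + b \<bullet> (G *\<^sub>v b) = x * (N + P)"
      using 1 2 unfolding N_def P_def by (simp add: algebra_simps)
    then show ?thesis using PN by simp
  qed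
  have "(x\<^sup>2 + y\<^sup>2) * N = (x\<^sup>2 + y\<^sup>2) * P" using PN by simp
  also have "\<dots> = (H\<^sup>T *\<^sub>v a) \<bullet> (H\<^sup>T *\<^sub>v a) + (H\<^sup>T *\<^sub>v b) \<bullet> (H\<^sup>T *\<^sub>v b)"
    unfolding 5 6 P_def by (simp add: algebra_simps)
  also have "\<dots> \<le> t * N"
    using H_up[OF car(1)] H_up[OF car(2)] unfolding N_def by (simp add: algebra_simps)
  finally have h: "x\<^sup>2 + y\<^sup>2 \<le> t" using N by simp
  have "\<alpha> * N \<le> 2 * x * N" "2 * x * N \<le> \<beta> * N"
    using G_low[OF car(1)] G_low[OF car(2)] G_up[OF car(1)] G_up[OF car(2)] g
    unfolding N_def by (simp_all add: algebra_simps)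
  then have bounds: "\<alpha> / 2 \<le> x" "x \<le> \<beta> / 2" using N by simp_all
  then show "\<alpha> / 2 \<le> Re l" "Re l \<le> \<beta> / 2" by (simp_all add: x_def)
  \<comment> \<open>The bound on |l|^2 leaves for the imaginary part what the real part does not
    use; squaring the lower bound on the real part relies on \<alpha> being nonnegative.\<close>
  have "(\<alpha> / 2)\<^sup>2 \<le> x\<^sup>2" using bounds(1) \<open>0 \<le> \<alpha>\<close> by (intro power_mono) auto
  with h show "(Im l)\<^sup>2 \<le> t - \<alpha>\<^sup>2 / 4" by (simp add: y_def power_divide)
qed

text \<open>Below \<open>\<alpha>\<close> the matrix \<open>N = G - \<mu> I\<close> satisfies \<open>0 \<le> N \<le> (\<beta> - \<mu>) I\<close>, hence
  \<open>N\<^sup>2 \<le> (\<beta> - \<mu>) N\<close>. Applied to \<open>N u = - H p\<close> this yields the quadratic inequality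
  \<open>s \<le> \<mu> (\<beta> - \<mu>)\<close>; so there are no real eigenvalues below \<open>\<alpha>\<close> when its discriminant is negative.\<close>
lemma saddle_real_eigenvalue:
  fixes G H :: "real mat" and \<mu> :: real
  assumes G: "G \<in> carrier_mat n n" "G\<^sup>T = G" and H: "H \<in> carrier_mat n m"
    and G_low: "\<And>v. v \<in> carrier_vec n \<Longrightarrow> \<alpha> * (v \<bullet> v) \<le> v \<bullet> (G *\<^sub>v v)"
    and G_up: "\<And>v. v \<in> carrier_vec n \<Longrightarrow> v \<bullet> (G *\<^sub>v v) \<le> \<beta> * (v \<bullet> v)"
    and H_low: "\<And>p. p \<in> carrier_vec m \<Longrightarrow> s * (p \<bullet> p) \<le> (H *\<^sub>v p) \<bullet> (H *\<^sub>v p)"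
    and \<alpha>\<beta>: "0 \<le> \<alpha>" "\<alpha> \<le> \<beta>"
    and ev: "eigenvalue (complex_mat (four_block_mat G H (- H\<^sup>T) (0\<^sub>m m m))) (of_real \<mu>)"
  shows "min \<alpha> (2 * s / (\<beta> + sqrt (\<beta>\<^sup>2 - 4 * s))) \<le> \<mu>" and "\<mu> \<le> \<beta>"
proof -
  let ?X = "four_block_mat G H (- H\<^sup>T) (0\<^sub>m m m)"
  have X: "?X \<in> carrier_mat (n + m) (n + m)" using G H by auto
  from complex_mat_eigenvalue_real_parts[OF X ev]
  obtain a b where ab: "a \<in> carrier_vec (n + m)" "b \<in> carrier_vec (n + m)"
      "a \<noteq> 0\<^sub>v (n + m) \<or> b \<noteq> 0\<^sub>v (n + m)"
    and Xa: "?X *\<^sub>v a = Re (of_real \<mu>) \<cdot>\<^sub>v a + (- Im (of_real \<mu>)) \<cdot>\<^sub>v b"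
    and Xb: "?X *\<^sub>v b = Re (of_real \<mu>) \<cdot>\<^sub>v b + Im (of_real \<mu>) \<cdot>\<^sub>v a"
    by blast
  \<comment> \<open>For a real eigenvalue each nonzero part of the complex eigenvector is itself a
    real eigenvector. The zero term only fits the equation to
    \<open>saddle_block_mult\<close>.\<close>
  have "0 \<cdot>\<^sub>v a = 0 \<cdot>\<^sub>v b" using ab by (intro eq_vecI) auto
  with Xa Xb have "?X *\<^sub>v a = \<mu> \<cdot>\<^sub>v a + 0 \<cdot>\<^sub>v a" "?X *\<^sub>v b = \<mu> \<cdot>\<^sub>v b + 0 \<cdot>\<^sub>v b" by simp_all
  with ab obtain v where v: "v \<in> carrier_vec (n + m)" "v \<noteq> 0\<^sub>v (n + m)"
    and Xv: "?X *\<^sub>v v = \<mu> \<cdot>\<^sub>v v + 0 \<cdot>\<^sub>v v"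
    by blast
  define u p where "u = vec_first v n" and "p = vec_last v m"
  have car: "u \<in> carrier_vec n" "p \<in> carrier_vec m" by (simp_all add: u_def p_def)
  have nz: "0 < u \<bullet> u + p \<bullet> p" using append_vec_nonzero[OF v] by (simp add: u_def p_def)
  have Gu: "G *\<^sub>v u + H *\<^sub>v p = \<mu> \<cdot>\<^sub>v u" and Hu: "H\<^sup>T *\<^sub>v u = (- \<mu>) \<cdot>\<^sub>v p"
    using saddle_block_mult[OF G(1) H v(1) v(1) Xv, folded u_def p_def] car by auto
  have uHp: "u \<bullet> (H *\<^sub>v p) = - \<mu> * (p \<bullet> p)"
    using scalar_prod_transpose[OF H car] car by (simp add: Hu)
  \<comment> \<open>This makes \<mu> the quotient of u . G u by the squared norm of the whole
    vector, which gives its sign and its upper bound.\<close>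
  have q: "u \<bullet> (G *\<^sub>v u) = \<mu> * (u \<bullet> u + p \<bullet> p)"
    using arg_cong[OF Gu, of "\<lambda>z. u \<bullet> z"] car G H
    by (simp add: scalar_prod_linear_dim uHp algebra_simps)
  have "0 \<le> \<alpha> * (u \<bullet> u)" using \<alpha>\<beta>(1) real_scalar_prod_self_ge_0 by simp
  then have "0 \<le> \<mu> * (u \<bullet> u + p \<bullet> p)" using G_low[OF car(1)] q by simp
  then have \<mu>0: "0 \<le> \<mu>" using nz by (simp add: zero_le_mult_iff)
  have "\<mu> * (u \<bullet> u + p \<bullet> p) \<le> \<beta> * (u \<bullet> u)" using G_up[OF car(1)] q by simp
  also have "\<dots> \<le> \<beta> * (u \<bullet> u + p \<bullet> p)"
    using \<alpha>\<beta> real_scalar_prod_self_ge_0[of p] by (intro mult_left_mono) auto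
  finally show "\<mu> \<le> \<beta>" using nz by simp
  show "min \<alpha> (2 * s / (\<beta> + sqrt (\<beta>\<^sup>2 - 4 * s))) \<le> \<mu>"
  proof (cases "\<alpha> \<le> \<mu>")
    \<comment> \<open>Only here is the fraction the relevant bound. Otherwise the minimum is at most
      \<alpha>, whatever value the root of a negative discriminant has.\<close>
    case False
    define c where "c = \<beta> - \<mu>"
    have c: "0 < c" using False \<alpha>\<beta> by (simp add: c_def)
    define z where "z = H *\<^sub>v p"
    have z: "z \<in> carrier_vec n" using H car by (simp add: z_def)
    have Gu': "G *\<^sub>v u = \<mu> \<cdot>\<^sub>v u - z"
      using Gu G H car by (auto simp: z_def vec_eq_iff)
    \<comment> \<open>Since N u = -z, this is y = (I - N / c) u. The identity c N (c - N) = (c - N)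
      N (c - N) + N (c - N) N reduces N^2 \<le> c N to two quadratic forms: N at y, bounded below by
      \<open>G_low\<close>, and c - N at z, bounded by \<open>G_up\<close>.\<close>
    define y where "y = u + (1 / c) \<cdot>\<^sub>v z"
    have y: "y \<in> carrier_vec n" using car z by (simp add: y_def)
    have uz: "u \<bullet> z = - \<mu> * (p \<bullet> p)" "z \<bullet> u = - \<mu> * (p \<bullet> p)"
      using uHp comm_scalar_prod[OF z car(1)] by (simp_all add: z_def)
    have Gz: "u \<bullet> (G *\<^sub>v z) = \<mu> * (u \<bullet> z) - z \<bullet> z"
      using scalar_prod_transpose[OF G(1) car(1) z] G car z by (simp add: Gu' scalar_prod_linear_dim)
    have zG: "z \<bullet> (G *\<^sub>v u) = \<mu> * (u \<bullet> z) - z \<bullet> z"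
      using car z uz by (simp add: Gu' scalar_prod_linear_dim)
    have Gy: "G *\<^sub>v y = G *\<^sub>v u + (1 / c) \<cdot>\<^sub>v (G *\<^sub>v z)"
      using G car z by (simp add: y_def mult_add_distrib_mat_vec[of _ n n] mult_mat_vec[of _ n n])
    have uGu: "u \<bullet> (G *\<^sub>v u) = \<mu> * (u \<bullet> u) - u \<bullet> z"
      using q uz by (simp add: algebra_simps)
    have yGy: "y \<bullet> (G *\<^sub>v y) = \<mu> * (u \<bullet> u) - u \<bullet> z + 2 / c * (\<mu> * (u \<bullet> z) - z \<bullet> z) + (1 / c)\<^sup>2 * (z \<bullet> (G *\<^sub>v z))"
      unfolding Gy unfolding y_def using G car z
      by (simp add: scalar_prod_linear_dim uGu Gz zG power2_eq_square algebra_simps)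
    have yy: "y \<bullet> y = u \<bullet> u + 2 / c * (u \<bullet> z) + (1 / c)\<^sup>2 * (z \<bullet> z)"
      unfolding y_def using car z by (simp add: scalar_prod_linear_dim uz power2_eq_square algebra_simps)
    have "\<mu> * (y \<bullet> y) \<le> \<alpha> * (y \<bullet> y)"
      using False real_scalar_prod_self_ge_0[of y] by (intro mult_right_mono) auto
    also have "\<dots> \<le> y \<bullet> (G *\<^sub>v y)" by (rule G_low[OF y])
    finally have "0 \<le> - (u \<bullet> z) - 2 / c * (z \<bullet> z) + (1 / c)\<^sup>2 * (z \<bullet> (G *\<^sub>v z) - \<mu> * (z \<bullet> z))"
      unfolding yGy yy by (simp add: algebra_simps)
    also have "\<dots> \<le> - (u \<bullet> z) - 2 / c * (z \<bullet> z) + (1 / c)\<^sup>2 * (c * (z \<bullet> z))"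
      using G_up[OF z] by (intro add_left_mono mult_left_mono) (auto simp: c_def algebra_simps)
    also have "\<dots> = \<mu> * (p \<bullet> p) - (z \<bullet> z) / c"
      using c by (simp add: uz power2_eq_square field_simps)
    finally have "z \<bullet> z \<le> c * \<mu> * (p \<bullet> p)" using c by (simp add: field_simps)
    then have "s * (p \<bullet> p) \<le> c * \<mu> * (p \<bullet> p)" using H_low[OF car(2)] by (simp add: z_def)
    \<comment> \<open>If p were zero, u would be an eigenvector of G for a value below
      \<alpha>.\<close>
    moreover have "p \<bullet> p > 0"
    proof (rule ccontr)
      assume "\<not> p \<bullet> p > 0"
      then have pp: "p \<bullet> p = 0" using real_scalar_prod_self_ge_0[of p] by simp
      then have "\<alpha> * (u \<bullet> u) \<le> \<mu> * (u \<bullet> u)" using G_low[OF car(1)] q by simp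
      with nz pp False show False by simp
    qed
    ultimately have s: "s \<le> \<mu> * (\<beta> - \<mu>)" by (simp add: c_def mult.commute)
    \<comment> \<open>Completing the square shows at once that the discriminant is nonnegative and
      that its root is at least \<beta> - 2 \<mu>, so \<mu> is not below the smaller root.\<close>
    have sq: "\<beta>\<^sup>2 - 4 * s = (\<beta> - 2 * \<mu>)\<^sup>2 + 4 * (\<mu> * (\<beta> - \<mu>) - s)"
      by (simp add: power2_eq_square algebra_simps)
    define r where "r = sqrt (\<beta>\<^sup>2 - 4 * s)"
    have disc: "0 \<le> \<beta>\<^sup>2 - 4 * s" unfolding sq using s by simp
    have r: "0 \<le> r" "r\<^sup>2 = \<beta>\<^sup>2 - 4 * s" using disc by (simp_all add: r_def)
    have "\<beta> - 2 * \<mu> \<le> r"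
      unfolding r_def by (rule real_le_rsqrt) (use sq s in simp)
    \<comment> \<open>This undoes the rationalization; the denominator is positive because \<beta>
      \<ge> \<alpha> > \<mu> \<ge> 0.\<close>
    moreover have "2 * s / (\<beta> + r) = (\<beta> - r) / 2"
    proof -
      have "4 * s = (\<beta> - r) * (\<beta> + r)" using r(2) by (simp add: power2_eq_square algebra_simps)
      moreover have "\<beta> + r > 0" using r(1) False \<mu>0 \<alpha>\<beta> by linarith
      ultimately show ?thesis by (simp add: field_simps)
    qed
    ultimately show ?thesis unfolding r_def by simp
  qed simp
qed

section \<open>Block triangular factors and similarity\<close>

lemma transpose_mult3:
  fixes A :: "'a :: comm_semiring_0 mat"
  assumes "A \<in> carrier_mat n m" and "B \<in> carrier_mat m k" and "C \<in> carrier_mat k l"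
  shows "(A * B * C)\<^sup>T = C\<^sup>T * B\<^sup>T * A\<^sup>T"
  using assms transpose_mult[of "A * B" n k C l] transpose_mult[of A n m B k]
  by (simp add: mat_mult_assoc_dim)

lemma unit_lower_block_inverse:
  fixes Z :: "'a :: comm_ring_1 mat"
  assumes Z: "Z \<in> carrier_mat m n"
  shows "four_block_mat (1\<^sub>m n) (0\<^sub>m n m) Z (1\<^sub>m m) * four_block_mat (1\<^sub>m n) (0\<^sub>m n m) (- Z) (1\<^sub>m m)
    = 1\<^sub>m (n + m)"
proof -
  have "Z + - Z = 0\<^sub>m m n" using Z by (auto intro!: eq_matI)
  moreover have "1\<^sub>m n + - 0\<^sub>m n n = (1\<^sub>m n :: 'a mat)" by (auto intro!: eq_matI)
  ultimately show ?thesis using Z by (subst mult_four_block_mat[of _ n n _ m _ m _ _ n _ m]) auto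
qed

lemma mult_unit_lower_block:
  fixes P :: "'a :: comm_ring_1 mat"
  assumes "P \<in> carrier_mat n n" and "V \<in> carrier_mat n m" and "W \<in> carrier_mat m n"
    and Z: "Z \<in> carrier_mat m n"
  shows "four_block_mat P V W (0\<^sub>m m m) * four_block_mat (1\<^sub>m n) (0\<^sub>m n m) (- Z) (1\<^sub>m m)
    = four_block_mat (P + V * - Z) V W (0\<^sub>m m m)"
proof -
  have "- 0\<^sub>m m n = (0\<^sub>m m n :: 'a mat)" by (auto intro!: eq_matI)
  then show ?thesis using assms by (subst mult_four_block_mat[of _ n n _ m _ m _ _ n _ m]) auto
qed

lemma spectrum_similar:
  fixes M :: "'a :: field mat"
  assumes "M \<in> carrier_mat n n" and "N \<in> carrier_mat n n" and "similar_mat M N"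
  shows "spectrum M = spectrum N"
  using assms by (simp add: spectrum_root_char_poly char_poly_similar)

section \<open>Singular values\<close>

lemma gram_sym_pos_semidef:
  assumes H: "H \<in> carrier_mat n m"
  shows "sym_pos_semidef m (H\<^sup>T * H)"
proof -
  have "0 \<le> p \<bullet> (H\<^sup>T * H *\<^sub>v p)" if "p \<in> carrier_vec m" for p
    using scalar_prod_transpose[of "H\<^sup>T" m n p "H *\<^sub>v p"] H that real_scalar_prod_self_ge_0
    by (simp add: mat_vec_assoc_dim)
  then show ?thesis using H by (auto simp: sym_pos_semidef_def transpose_mult)
qed

text \<open>The singular values come from \<open>H\<^sup>T * H\<close>, whereas the second bound
  concerns \<open>H\<^sup>T\<close> on the larger space. It is derived from the first Gram matrix
  alone, without comparing its spectrum with that of \<open>H * H\<^sup>T\<close>.\<close>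

lemma singular_value_bounds:
  assumes H: "H \<in> carrier_mat n m" and m: "0 < m"
  shows "\<And>p. p \<in> carrier_vec m \<Longrightarrow> (sigma_min H)\<^sup>2 * (p \<bullet> p) \<le> (H *\<^sub>v p) \<bullet> (H *\<^sub>v p)"
    and "\<And>v. v \<in> carrier_vec n \<Longrightarrow> (H\<^sup>T *\<^sub>v v) \<bullet> (H\<^sup>T *\<^sub>v v) \<le> (sigma_max H)\<^sup>2 * (v \<bullet> v)"
    and "0 \<le> sigma_max H"
proof -
  let ?K = "H\<^sup>T * H"
  have psd: "sym_pos_semidef m ?K" by (rule gram_sym_pos_semidef[OF H])
  have K: "?K \<in> carrier_mat m m" "?K\<^sup>T = ?K" using psd by (auto simp: sym_pos_semidef_def)
  have fin: "finite (spectrum ?K)" by (rule card_finite_spectrum(1)[OF K(1)])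
  have ne: "spectrum ?K \<noteq> {}" by (rule symmetric_spectrum_nonempty[OF K m])
  have low: "lambda_min ?K \<in> spectrum ?K" and up: "lambda_max ?K \<in> spectrum ?K"
    unfolding lambda_min_def lambda_max_def using fin ne by auto
  have nonneg: "0 \<le> e" if "e \<in> spectrum ?K" for e using sym_pos_semidef_spectrum[OF psd that] .
  have "sigma_min H \<in> singular_values H"
    unfolding sigma_min_def singular_values_def using fin ne by (intro Min_in) auto
  then have smin0: "0 \<le> sigma_min H" using nonneg by (auto simp: singular_values_def)
  have "sigma_min H \<le> sqrt (lambda_min ?K)"
    unfolding sigma_min_def singular_values_def using fin low by (intro Min_le) auto
  then have smin: "(sigma_min H)\<^sup>2 \<le> lambda_min ?K"
    using smin0 power_mono[of "sigma_min H" "sqrt (lambda_min ?K)" 2] nonneg[OF low] by simp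
  have smax_ge: "sqrt (lambda_max ?K) \<le> sigma_max H"
    unfolding sigma_max_def singular_values_def using fin up by (intro Max_ge) auto
  then show "0 \<le> sigma_max H" using nonneg[OF up] real_sqrt_ge_zero order_trans by blast
  have smax: "lambda_max ?K \<le> (sigma_max H)\<^sup>2"
    using smax_ge power_mono[of "sqrt (lambda_max ?K)" "sigma_max H" 2] nonneg[OF up] by simp
  have Hpp: "(H *\<^sub>v p) \<bullet> (H *\<^sub>v p) = p \<bullet> (?K *\<^sub>v p)" if "p \<in> carrier_vec m" for p
    using scalar_prod_transpose[of "H\<^sup>T" m n p "H *\<^sub>v p"] H that by (simp add: mat_vec_assoc_dim)
  show "(sigma_min H)\<^sup>2 * (p \<bullet> p) \<le> (H *\<^sub>v p) \<bullet> (H *\<^sub>v p)" if p: "p \<in> carrier_vec m" for p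
    using symmetric_rayleigh_bounds(1)[OF K p] mult_right_mono[OF smin real_scalar_prod_self_ge_0[of p]]
    by (simp add: Hpp[OF p])
  show "(H\<^sup>T *\<^sub>v v) \<bullet> (H\<^sup>T *\<^sub>v v) \<le> (sigma_max H)\<^sup>2 * (v \<bullet> v)" if v: "v \<in> carrier_vec n" for v
  proof -
    define t where "t = (sigma_max H)\<^sup>2"
    define q where "q = H\<^sup>T *\<^sub>v v"
    define z where "z = H *\<^sub>v q"
    have q: "q \<in> carrier_vec m" and z: "z \<in> carrier_vec n" using H v by (simp_all add: q_def z_def)
    have vz: "v \<bullet> z = q \<bullet> q" unfolding z_def q_def using scalar_prod_transpose[OF H v q] by (simp add: q_def)
    have zz: "z \<bullet> z \<le> t * (q \<bullet> q)"
      using symmetric_rayleigh_bounds(2)[OF K q] mult_right_mono[OF smax real_scalar_prod_self_ge_0[of q]]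
      by (simp add: z_def t_def Hpp[OF q])
    show ?thesis
    proof (cases "t = 0")
      case True
      then have "z \<bullet> z = 0" using zz real_scalar_prod_self_ge_0[of z] by simp
      then have "z = 0\<^sub>v n" using real_scalar_prod_self_eq_0[OF z] by simp
      then show ?thesis using vz v True by (simp add: q_def[symmetric] t_def[symmetric])
    next
      case False
      then have t: "0 < t" by (simp add: t_def)
      \<comment> \<open>Expanding |t v - H q|^2 \<ge> 0 with v . H q = |q|^2 and |H q|^2 \<le> t
        |q|^2 leaves t (t |v|^2 - |q|^2) \<ge> 0. The factor t has to be cancelled, hence the
        separate case t = 0.\<close>
      let ?y = "t \<cdot>\<^sub>v v - z"
      have "0 \<le> ?y \<bullet> ?y" by (rule real_scalar_prod_self_ge_0)
      also have "?y \<bullet> ?y = t * t * (v \<bullet> v) - 2 * t * (v \<bullet> z) + z \<bullet> z"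
        using v z by (simp add: scalar_prod_linear_dim comm_scalar_prod[OF z v] algebra_simps)
      also have "\<dots> \<le> t * (t * (v \<bullet> v) - q \<bullet> q)" using zz by (simp add: vz algebra_simps)
      finally show ?thesis using t by (simp add: zero_le_mult_iff q_def t_def)
    qed
  qed
qed

section \<open>The preconditioned saddle-point matrix\<close>

text \<open>\<open>Minv * A\<close> is brought to the block form by the unit lower triangular factor of the
  preconditioner, followed by the scaling with the square roots \<open>R\<close> and \<open>Q\<close>.\<close>
lemma preconditioned_saddle_similar:
  fixes A B C S :: "real mat"
  defines "R \<equiv> spd_sqrt S" and "Q \<equiv> spd_sqrt C" and "Ri \<equiv> inv_sqrt S" and "Qi \<equiv> inv_sqrt C"
  defines "K \<equiv> primal_schur A B C + B * minv C * B\<^sup>T"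
  defines "H \<equiv> Ri * B * Qi"
  assumes A: "A \<in> carrier_mat n n" and B: "B \<in> carrier_mat n m"
    and C: "sym_pos_def m C" and S: "sym_pos_def n S"
  shows "similar_mat (precond_inv B C S * saddle_mat A B)
    (four_block_mat (Ri * K * Ri) H (- H\<^sup>T) (0\<^sub>m m m))"
proof -
  define Ci Si where "Ci = minv C" and "Si = minv S"
  note iS = sym_pos_def_inverse[OF spd_sqrt(1)[OF S], folded R_def Ri_def]
    and iC = sym_pos_def_inverse[OF spd_sqrt(1)[OF C], folded Q_def Qi_def]
  have car: "R \<in> carrier_mat n n" "Q \<in> carrier_mat m m" "Ri \<in> carrier_mat n n" "Qi \<in> carrier_mat m m"
    "Ci \<in> carrier_mat m m" "Si \<in> carrier_mat n n"
    using spd_sqrt(1)[OF S] spd_sqrt(1)[OF C] iS(3) iC(3) sym_pos_def_inverse(3)[OF C]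
      sym_pos_def_inverse(3)[OF S]
    by (simp_all add: sym_pos_def_def R_def Q_def Ci_def Si_def)
  have sym: "Ri\<^sup>T = Ri" "Qi\<^sup>T = Qi" using iS(3) iC(3) by (simp_all add: sym_pos_def_def)
  have Ri2: "Ri * Ri = Si" and Qi2: "Qi * Qi = Ci"
    using inv_sqrt_square[OF S] inv_sqrt_square[OF C] by (simp_all add: Ri_def Qi_def Si_def Ci_def)
  define Su where "Su = primal_schur A B C"
  have Su: "Su = A + B * Ci * B\<^sup>T" by (simp add: Su_def primal_schur_def Ci_def)
  have K: "K = Su + B * Ci * B\<^sup>T" by (simp add: K_def Su_def Ci_def)
  have BT: "B\<^sup>T \<in> carrier_mat m n" using B by simp
  have Suc: "Su \<in> carrier_mat n n" using A B car by (auto simp: Su)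
  have Kc: "K \<in> carrier_mat n n" using Suc B car by (auto simp: K)
  have Hc: "H \<in> carrier_mat n m" using B car by (auto simp: H_def)
  have HT: "H\<^sup>T = Qi * B\<^sup>T * Ri"
    unfolding H_def using B car sym
    by (subst transpose_mult3[of _ n n _ m _ m]) simp_all
  let ?X = "four_block_mat (Ri * K * Ri) H (- H\<^sup>T) (0\<^sub>m m m)"
  let ?L = "four_block_mat (1\<^sub>m n) (0\<^sub>m n m) (Ci * B\<^sup>T) (1\<^sub>m m)"
  let ?Li = "four_block_mat (1\<^sub>m n) (0\<^sub>m n m) (- (Ci * B\<^sup>T)) (1\<^sub>m m)"
  let ?D = "four_block_mat R (0\<^sub>m n m) (0\<^sub>m m n) Q"
  let ?Di = "four_block_mat Ri (0\<^sub>m n m) (0\<^sub>m m n) Qi"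
  let ?E = "four_block_mat Si (0\<^sub>m n m) (0\<^sub>m m n) (- Ci)"
  let ?F = "four_block_mat (1\<^sub>m n) (B * Ci) (0\<^sub>m m n) (1\<^sub>m m)"
  let ?A = "four_block_mat A B B\<^sup>T (0\<^sub>m m m)"
  have carX: "?X \<in> carrier_mat (n + m) (n + m)" "?L \<in> carrier_mat (n + m) (n + m)"
    "?Li \<in> carrier_mat (n + m) (n + m)" "?D \<in> carrier_mat (n + m) (n + m)"
    "?Di \<in> carrier_mat (n + m) (n + m)" "?E \<in> carrier_mat (n + m) (n + m)"
    "?F \<in> carrier_mat (n + m) (n + m)" "?A \<in> carrier_mat (n + m) (n + m)"
    using car A B Hc Kc by auto
  have CBc: "Ci * B\<^sup>T \<in> carrier_mat m n" "B * Ci \<in> carrier_mat n m" using car B by auto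
  have MA: "precond_inv B C S * saddle_mat A B = ?L * ?E * ?F * ?A"
    using B by (simp add: precond_inv_def saddle_mat_def Ci_def Si_def)
  have LLi: "?L * ?Li = 1\<^sub>m (n + m)" and LiL: "?Li * ?L = 1\<^sub>m (n + m)"
    using unit_lower_block_inverse[OF CBc(1)] mat_mult_left_right_inverse carX(2,3) by blast+
  have DDi: "?D * ?Di = 1\<^sub>m (n + m)" and DiD: "?Di * ?D = 1\<^sub>m (n + m)"
    using car iS iC by (auto simp: mult_four_block_mat[of _ n n _ m _ m _ _ n _ m])
  \<comment> \<open>The upper triangular factor is a block elimination that creates the Schur
    complement.\<close>
  have FA: "?F * ?A = four_block_mat Su B B\<^sup>T (0\<^sub>m m m)"
    using A B BT CBc car by (subst mult_four_block_mat[of _ n n _ m _ m _ _ n _ m]) (auto simp: Su)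
  have EFA: "?E * (?F * ?A) = four_block_mat (Si * Su) (Si * B) (- (Ci * B\<^sup>T)) (0\<^sub>m m m)"
    unfolding FA using Suc B BT car by (subst mult_four_block_mat[of _ n n _ m _ m _ _ n _ m]) auto
  have prod: "Ri * K \<in> carrier_mat n n" "Ri * B \<in> carrier_mat n m" "Qi * B\<^sup>T \<in> carrier_mat m n"
    "Si * K \<in> carrier_mat n n" "Si * B \<in> carrier_mat n m"
    using car Kc B by auto
  \<comment> \<open>The right scaling cancels one root in each block; the left scaling then merges
    the remaining roots into full inverses.\<close>
  have XD: "?X * ?D = four_block_mat (Ri * K) (Ri * B) (- (Qi * B\<^sup>T)) (0\<^sub>m m m)"
  proof -
    have "Ri * K * Ri * R = Ri * K * (Ri * R)" "H * Q = Ri * B * (Qi * Q)" "H\<^sup>T * R = Qi * B\<^sup>T * (Ri * R)"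
      unfolding HT unfolding H_def using car Kc B by (simp_all add: mat_mult_assoc_dim)
    then have "Ri * K * Ri * R = Ri * K" "H * Q = Ri * B" "(- H\<^sup>T) * R = - (Qi * B\<^sup>T)"
      using iS iC car Kc B Hc by auto
    then show ?thesis
      using car Kc Hc prod by (subst mult_four_block_mat[of _ n n _ m _ m _ _ n _ m]) auto
  qed
  have DXD: "?Di * (?X * ?D) = four_block_mat (Si * K) (Si * B) (- (Ci * B\<^sup>T)) (0\<^sub>m m m)"
  proof -
    have "Ri * (Ri * K) = Si * K" "Ri * (Ri * B) = Si * B" "Qi * (Qi * B\<^sup>T) = Ci * B\<^sup>T"
      unfolding Ri2[symmetric] Qi2[symmetric] using car Kc B by (simp_all add: mat_mult_assoc_dim)
    then show ?thesis
      unfolding XD using car Kc B BT prod CBc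
      by (subst mult_four_block_mat[of _ n n _ m _ m _ _ n _ m]) auto
  qed
  \<comment> \<open>Removing the lower triangular factor subtracts exactly the additional B C^(-1)
    B^T in K and leaves the Schur complement.\<close>
  have "Si * K + Si * B * (- (Ci * B\<^sup>T)) = Si * Su"
  proof -
    define V W where "V = Si * Su" and "W = Si * (B * Ci * B\<^sup>T)"
    have VW: "V \<in> carrier_mat n n" "W \<in> carrier_mat n n"
      using car Suc B BT CBc by (auto simp: V_def W_def)
    have "Si * K = V + W"
      unfolding V_def W_def K using car Suc B by (intro mult_add_distrib_mat) auto
    moreover have "Si * B * (Ci * B\<^sup>T) = W"
      unfolding W_def using car B by (simp add: mat_mult_assoc_dim)
    then have "Si * B * (- (Ci * B\<^sup>T)) = - W"
      using car B by (subst uminus_mult_right_mat) auto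
    ultimately have "Si * K + Si * B * (- (Ci * B\<^sup>T)) = V + W + - W" by simp
    also have "\<dots> = V" using VW by (auto intro!: eq_matI)
    finally show ?thesis by (simp add: V_def)
  qed
  then have DXDL: "?Di * (?X * ?D) * ?Li = ?E * (?F * ?A)"
    unfolding DXD EFA using mult_unit_lower_block[OF prod(4,5) _ CBc(1), of "- (Ci * B\<^sup>T)"] CBc(1) by simp
  \<comment> \<open>The conjugating matrix is the triangular factor times the inverse scaling, so
    the inverse factors appear in the opposite order.\<close>
  have "similar_mat_wit (?L * ?E * ?F * ?A) ?X (?L * ?Di) (?D * ?Li)"
  proof (rule similar_mat_witI[of _ _ "n + m"])
    have "?L * ?Di * (?D * ?Li) = ?L * (?Di * ?D) * ?Li"
      using carX(2-5) by (simp only: mat_mult_assoc_dim carrier_matD index_mult_mat)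
    then show "?L * ?Di * (?D * ?Li) = 1\<^sub>m (n + m)"
      unfolding DiD right_mult_one_mat[OF carX(2)] LLi .
    have "?D * ?Li * (?L * ?Di) = ?D * (?Li * ?L) * ?Di"
      using carX(2-5) by (simp only: mat_mult_assoc_dim carrier_matD index_mult_mat)
    then show "?D * ?Li * (?L * ?Di) = 1\<^sub>m (n + m)"
      unfolding LiL right_mult_one_mat[OF carX(4)] DDi .
    have "?L * ?E * ?F * ?A = ?L * (?E * (?F * ?A))"
      using carX by (simp only: mat_mult_assoc_dim carrier_matD index_mult_mat)
    also have "\<dots> = ?L * ?Di * ?X * (?D * ?Li)"
      unfolding DXDL[symmetric] using carX by (simp only: mat_mult_assoc_dim carrier_matD index_mult_mat)
    finally show "?L * ?E * ?F * ?A = ?L * ?Di * ?X * (?D * ?Li)" .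
  qed (rule carX mult_carrier_mat)+
  then show ?thesis unfolding MA similar_mat_def by blast
qed

section \<open>Eigenvalue bounds for the preconditioned matrix\<close>

theorem theorem2p2:
  fixes n\<^sub>u n\<^sub>t :: nat
    and A B C S\<^sub>u St\<^sub>u \<A> Minv :: "real mat"
    and \<alpha>\<^sub>u \<beta>\<^sub>u \<alpha>\<^sub>t \<beta>\<^sub>t :: real
  assumes "0 < n\<^sub>t" and "n\<^sub>t < n\<^sub>u"
    and "sym_pos_semidef n\<^sub>u A"
    and "B \<in> carrier_mat n\<^sub>u n\<^sub>t" and "vec_space.rank n\<^sub>u B = n\<^sub>t"
    and "sym_pos_def n\<^sub>t C"
    and "S\<^sub>u = primal_schur A B C"
    and "sym_pos_def n\<^sub>u St\<^sub>u"
    and "\<A> = saddle_mat A B"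
    and "Minv = precond_inv B C St\<^sub>u"
    and "\<alpha>\<^sub>u = lambda_min (minv St\<^sub>u * (S\<^sub>u + B * minv C * B\<^sup>T))"
    and "\<beta>\<^sub>u = lambda_max (minv St\<^sub>u * (S\<^sub>u + B * minv C * B\<^sup>T))"
    and "\<alpha>\<^sub>t = sigma_min (inv_sqrt St\<^sub>u * B * inv_sqrt C)"
    and "\<beta>\<^sub>t = sigma_max (inv_sqrt St\<^sub>u * B * inv_sqrt C)"
  shows "(\<forall>l::real. eigenvalue (complex_mat (Minv * \<A>)) (complex_of_real l) \<longrightarrow>
            min \<alpha>\<^sub>u (2 * \<alpha>\<^sub>t\<^sup>2 / (\<beta>\<^sub>u + sqrt (\<beta>\<^sub>u\<^sup>2 - 4 * \<alpha>\<^sub>t\<^sup>2))) \<le> l \<and> l \<le> \<beta>\<^sub>u)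
       \<and> (\<forall>l::complex. eigenvalue (complex_mat (Minv * \<A>)) l \<and> l \<notin> \<real> \<longrightarrow>
            \<alpha>\<^sub>u / 2 \<le> Re l \<and> Re l \<le> \<beta>\<^sub>u / 2 \<and>
            \<bar>Im l\<bar> \<le> sqrt (\<beta>\<^sub>t\<^sup>2 - \<alpha>\<^sub>u\<^sup>2 / 4))
       \<and> (2 * \<beta>\<^sub>t < \<alpha>\<^sub>u \<longrightarrow>
            \<not> (\<exists>l::complex. eigenvalue (complex_mat (Minv * \<A>)) l \<and> l \<notin> \<real>))"
proof -
  let ?n = "n\<^sub>u" and ?m = "n\<^sub>t"
  note B = assms(4) and C = assms(6) and S = assms(8)
  define R where "R = spd_sqrt St\<^sub>u"
  define Ri where "Ri = inv_sqrt St\<^sub>u"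
  define K where "K = S\<^sub>u + B * minv C * B\<^sup>T"
  define G where "G = Ri * K * Ri"
  define H where "H = Ri * B * inv_sqrt C"
  define X where "X = four_block_mat G H (- H\<^sup>T) (0\<^sub>m ?m ?m)"
  have A: "A \<in> carrier_mat ?n ?n" "A\<^sup>T = A" using assms(3) by (auto simp: sym_pos_semidef_def)
  note iS = sym_pos_def_inverse[OF spd_sqrt(1)[OF S], folded R_def Ri_def]
  have R: "R \<in> carrier_mat ?n ?n" and Ri: "Ri \<in> carrier_mat ?n ?n" "Ri\<^sup>T = Ri"
    using spd_sqrt(1)[OF S] iS(3) by (auto simp: sym_pos_def_def R_def)
  have Ci: "minv C \<in> carrier_mat ?m ?m" "(minv C)\<^sup>T = minv C"
    using sym_pos_def_inverse(3)[OF C] by (auto simp: sym_pos_def_def)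
  have Qi: "inv_sqrt C \<in> carrier_mat ?m ?m"
    using sym_pos_def_inverse(3)[OF spd_sqrt(1)[OF C]] by (auto simp: sym_pos_def_def)
  have H: "H \<in> carrier_mat ?n ?m" using Ri B Qi by (auto simp: H_def)
  define Y where "Y = B * minv C * B\<^sup>T"
  have Y: "Y \<in> carrier_mat ?n ?n" using B Ci by (auto simp: Y_def)
  have YT: "Y\<^sup>T = Y"
    unfolding Y_def using B Ci
    by (subst transpose_mult3[of _ ?n ?m _ ?m _ ?n]) (simp_all add: mat_mult_assoc_dim)
  have KY: "K = A + Y + Y" using assms(7) by (simp add: K_def Y_def primal_schur_def)
  have K: "K \<in> carrier_mat ?n ?n" using A Y by (auto simp: KY)
  have KT: "K\<^sup>T = K" unfolding KY using A Y YT by (simp add: transpose_add[of _ ?n ?n])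
  have Y_psd: "0 \<le> v \<bullet> (Y *\<^sub>v v)" if v: "v \<in> carrier_vec ?n" for v
  proof -
    have "Y *\<^sub>v v = B *\<^sub>v (minv C *\<^sub>v (B\<^sup>T *\<^sub>v v))"
      unfolding Y_def using B Ci(1) v by (simp add: mat_vec_assoc_dim mat_mult_assoc_dim)
    moreover have "minv C *\<^sub>v (B\<^sup>T *\<^sub>v v) \<in> carrier_vec ?m" using B Ci(1) v by simp
    ultimately have eq: "v \<bullet> (Y *\<^sub>v v) = (B\<^sup>T *\<^sub>v v) \<bullet> (minv C *\<^sub>v (B\<^sup>T *\<^sub>v v))"
      using scalar_prod_transpose[OF B v] by simp
    have "B\<^sup>T *\<^sub>v v \<in> carrier_vec ?m" using B v by simp
    then show ?thesis
      unfolding eq using sym_pos_def_inverse(3)[OF C] Ci(1)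
      by (cases "B\<^sup>T *\<^sub>v v = 0\<^sub>v ?m") (auto simp: sym_pos_def_def less_imp_le)
  qed
  have K_psd: "0 \<le> v \<bullet> (K *\<^sub>v v)" if v: "v \<in> carrier_vec ?n" for v
  proof -
    have "K *\<^sub>v v = A *\<^sub>v v + Y *\<^sub>v v + Y *\<^sub>v v"
      unfolding KY using A Y v by (simp add: add_mult_distrib_mat_vec[of _ ?n ?n] assoc_add_vec[of _ ?n])
    then have "v \<bullet> (K *\<^sub>v v) = v \<bullet> (A *\<^sub>v v) + v \<bullet> (Y *\<^sub>v v) + v \<bullet> (Y *\<^sub>v v)"
      using A Y v by (simp add: scalar_prod_linear_dim)
    then show ?thesis using Y_psd[OF v] v assms(3) by (auto simp: sym_pos_semidef_def)
  qed
  have Gc: "G \<in> carrier_mat ?n ?n" using Ri K by (auto simp: G_def)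
  have GT: "G\<^sup>T = G"
    unfolding G_def using Ri K KT
    by (subst transpose_mult3[of _ ?n ?n _ ?n _ ?n]) (simp_all add: mat_mult_assoc_dim)
  have "0 \<le> v \<bullet> (G *\<^sub>v v)" if v: "v \<in> carrier_vec ?n" for v
  proof -
    have "G *\<^sub>v v = Ri *\<^sub>v (K *\<^sub>v (Ri *\<^sub>v v))"
      unfolding G_def using Ri(1) K v by (simp add: mat_vec_assoc_dim mat_mult_assoc_dim)
    moreover have "K *\<^sub>v (Ri *\<^sub>v v) \<in> carrier_vec ?n" "Ri *\<^sub>v v \<in> carrier_vec ?n" using Ri(1) K v by simp_all
    ultimately show ?thesis
      using scalar_prod_transpose[OF Ri(1) v] K_psd[of "Ri *\<^sub>v v"] Ri(2) by simp
  qed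
  then have G_psd: "sym_pos_semidef ?n G" using Gc GT by (simp add: sym_pos_semidef_def)
  \<comment> \<open>The product defining \<open>\<alpha>\<^sub>u\<close> and
    \<open>\<beta>\<^sub>u\<close> need not be symmetric. It equals \<open>Ri * G * R\<close>, so it
    shares its spectrum with the symmetric matrix G, to which the Rayleigh bounds apply.\<close>
  have spec: "spectrum (minv St\<^sub>u * K) = spectrum G"
  proof (rule spectrum_similar)
    have Si: "minv St\<^sub>u = Ri * Ri" using inv_sqrt_square[OF S] by (simp add: Ri_def)
    show "minv St\<^sub>u * K \<in> carrier_mat ?n ?n" unfolding Si using Ri K by auto
    have "Ri * G * R = Ri * Ri * K * (Ri * R)"
      unfolding G_def using R Ri(1) K by (simp add: mat_mult_assoc_dim)
    then have "minv St\<^sub>u * K = Ri * G * R" unfolding Si using iS Ri(1) K by simp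
    then have "similar_mat_wit (minv St\<^sub>u * K) G Ri R"
      using iS Ri(1) R Gc K Si by (intro similar_mat_witI[of _ _ ?n]) auto
    then show "similar_mat (minv St\<^sub>u * K) G" unfolding similar_mat_def by blast
  qed (rule Gc)
  have \<alpha>\<beta>: "\<alpha>\<^sub>u = lambda_min G" "\<beta>\<^sub>u = lambda_max G"
    using assms(11,12) spec by (simp_all add: K_def lambda_min_def lambda_max_def)
  have n: "0 < ?n" using assms(1,2) by simp
  have fin: "finite (spectrum G)" and ne: "spectrum G \<noteq> {}"
    using card_finite_spectrum(1)[OF Gc] symmetric_spectrum_nonempty[OF Gc GT n] by auto
  have "lambda_min G \<in> spectrum G" unfolding lambda_min_def using fin ne by auto
  then have \<alpha>0: "0 \<le> \<alpha>\<^sub>u" and \<alpha>\<beta>_le: "\<alpha>\<^sub>u \<le> \<beta>\<^sub>u"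
    using sym_pos_semidef_spectrum[OF G_psd] fin by (auto simp: \<alpha>\<beta> lambda_max_def)
  have t: "\<alpha>\<^sub>t = sigma_min H" "\<beta>\<^sub>t = sigma_max H" using assms(13,14) by (simp_all add: H_def Ri_def)
  note sv = singular_value_bounds[OF H assms(1), folded t]
  note ray = symmetric_rayleigh_bounds[OF Gc GT, folded \<alpha>\<beta>]
  have X: "X \<in> carrier_mat (?n + ?m) (?n + ?m)" using Gc H by (auto simp: X_def)
  have sim: "similar_mat (Minv * \<A>) X"
    using preconditioned_saddle_similar[OF A(1) B C S] assms(7,9,10)
    by (simp add: X_def G_def H_def K_def Ri_def)
  then have MA: "Minv * \<A> \<in> carrier_mat (?n + ?m) (?n + ?m)"
    using X similar_matD[OF sim] by auto
  \<comment> \<open>Similarity was shown over the reals; the characteristic polynomials agree there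
    and remain equal after embedding into the complex numbers.\<close>
  have ev_iff: "eigenvalue (complex_mat (Minv * \<A>)) l \<longleftrightarrow> eigenvalue (complex_mat X) l" for l
    using MA X char_poly_similar[OF sim]
    by (simp add: eigenvalue_root_char_poly[of _ "?n + ?m"] of_real_hom.char_poly_hom)
  have real: "min \<alpha>\<^sub>u (2 * \<alpha>\<^sub>t\<^sup>2 / (\<beta>\<^sub>u + sqrt (\<beta>\<^sub>u\<^sup>2 - 4 * \<alpha>\<^sub>t\<^sup>2))) \<le> l \<and> l \<le> \<beta>\<^sub>u"
    if "eigenvalue (complex_mat (Minv * \<A>)) (complex_of_real l)" for l
    using saddle_real_eigenvalue[OF Gc GT H ray sv(1) \<alpha>0 \<alpha>\<beta>_le] that
    unfolding ev_iff X_def by blast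
  have nonreal: "\<alpha>\<^sub>u / 2 \<le> Re l" "Re l \<le> \<beta>\<^sub>u / 2" "(Im l)\<^sup>2 \<le> \<beta>\<^sub>t\<^sup>2 - \<alpha>\<^sub>u\<^sup>2 / 4"
    if "eigenvalue (complex_mat (Minv * \<A>)) l" and "l \<notin> \<real>" for l
  proof -
    have im: "Im l \<noteq> 0" using that(2) by (simp add: complex_is_Real_iff)
    show "\<alpha>\<^sub>u / 2 \<le> Re l" "Re l \<le> \<beta>\<^sub>u / 2" "(Im l)\<^sup>2 \<le> \<beta>\<^sub>t\<^sup>2 - \<alpha>\<^sub>u\<^sup>2 / 4"
      using saddle_nonreal_eigenvalue[OF Gc GT H ray sv(2) \<alpha>0 _ im] that(1)
      unfolding ev_iff X_def by blast+
  qed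
  have "\<bar>Im l\<bar> \<le> sqrt (\<beta>\<^sub>t\<^sup>2 - \<alpha>\<^sub>u\<^sup>2 / 4)"
    if "eigenvalue (complex_mat (Minv * \<A>)) l" and "l \<notin> \<real>" for l
    using nonreal(3)[OF that] by (intro real_le_rsqrt) simp
  \<comment> \<open>Contrapositive of the last claim: a non-real eigenvalue makes the radicand
    nonnegative, and \<open>sv(3)\<close> permits passing from squares to the values.\<close>
  moreover have "\<alpha>\<^sub>u \<le> 2 * \<beta>\<^sub>t"
    if "eigenvalue (complex_mat (Minv * \<A>)) l" and "l \<notin> \<real>" for l
  proof -
    have "\<alpha>\<^sub>u\<^sup>2 / 4 \<le> \<beta>\<^sub>t\<^sup>2" using nonreal(3)[OF that] zero_le_power2[of "Im l"] by linarith
    then have "\<alpha>\<^sub>u\<^sup>2 \<le> (2 * \<beta>\<^sub>t)\<^sup>2" by (simp add: power_mult_distrib)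
    then show ?thesis by (rule power2_le_imp_le) (use sv(3) in simp)
  qed
  ultimately show ?thesis using real nonreal(1,2) by (meson not_le)
qed

end
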